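(* The dagger 2-category $\mathbf{DagCat}$ admits the construction of FEM-algebras.
   Context: A dagger on a category $\mathbf{D}$ is a functor $\dagger\colon\mathbf{D}^{\mathrm{op}}\to\mathbf{D}$ with $A^\dagger=A$ on objects and $f^{\dagger\dagger}=f$ on morphisms; a dagger category is a category with a chosen dagger; a dagger functor is a functor commuting with daggers. $\mathbf{DagCat}$ is the category of small dagger categories and dagger functors, with its finite products. A dagger 2-category is a category enriched in $\mathbf{DagCat}$ (so each 2-cell $\phi\colon F\to G$ has a dagger $\phi^\dagger\colon G\to F$), and a dagger 2-functor is a $\mathbf{DagCat}$-enriched functor. $\mathbf{DagCat}$ itself is a dagger 2-category with natural transformations between dagger functors as 2-cells, the dagger of a natural transformation being taken componentwise. A dagger 2-adjunction consists of two $\mathbf{DagCat}$-enriched functors that form a 2-adjunction in the usual sense. Let $\mathbf{C}$ be a dagger 2-category. A dagger Frobenius monad in $\mathbf{C}$ consists of an object $C$, a morphism $T\colon C\to C$, and 2-cells $\eta\colon\mathrm{id}_C\to T$, $\mu\colon T^2\to T$ forming a monad in the underlying 2-category and satisfying $\mu T\circ T\mu^\dagger=T\mu\circ\mu^\dagger T$. A morphism of dagger Frobenius monads $(C,S)\to(D,T)$ is a morphism $F\colon C\to D$ with a 2-cell $\sigma\colon TF\to FS$ such that (1) $\sigma\circ\eta^TF=F\eta^S$; (2) $\sigma\circ\mu^TF=F\mu^S\circ\sigma S\circ T\sigma$; (3) $\sigma^\dagger\circ F\mu^S\circ\sigma S=\mu^TF\circ T\sigma^\dagger$. Composition is $(G,\tau)\circ(F,\sigma)=(GF,\,G\sigma\circ\tau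 F)$. A transformation $(F,\sigma)\to(G,\tau)$ between such morphisms $(C,S)\to(D,T)$ is a 2-cell $\phi\colon F\to G$ with $\tau\circ T\phi=\phi S\circ\sigma$ and $\sigma\circ T\phi^\dagger=\phi^\dagger S\circ\tau$. With the compositions and dagger of 2-cells of $\mathbf{C}$, this forms a dagger 2-category $\mathrm{DFMonad}(\mathbf{C})$. There is an inclusion dagger 2-functor $\mathbf{C}\to\mathrm{DFMonad}(\mathbf{C})$ given by $C\mapsto(C,\mathrm{id}_C)$, $F\mapsto(F,\mathrm{id})$, $\psi\mapsto\psi$. The dagger 2-category $\mathbf{C}$ admits the construction of FEM-algebras when this inclusion has a right adjoint $\mathrm{FEM}\colon\mathrm{DFMonad}(\mathbf{C})\to\mathbf{C}$ (in the sense of a dagger 2-adjunction). *)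

theory Defs
  imports "HOL-Library.FuncSet" "HOL-Library.Equipollence"
begin

section \<open>Dagger categories and dagger functors\<close>

record ('o, 'a) dagcat =
  Ob :: "'o set"
  Ar :: "'a set"
  Dom :: "'a \<Rightarrow> 'o"
  Cod :: "'a \<Rightarrow> 'o"
  Ident :: "'o \<Rightarrow> 'a"
  Cmp :: "'a \<Rightarrow> 'a \<Rightarrow> 'a"
    \<comment> \<open>\<open>Cmp C g f\<close> is \<open>g\<close> after \<open>f\<close>\<close>
  Dag :: "'a \<Rightarrow> 'a"

definition arrows :: "('o, 'a, 'm) dagcat_scheme \<Rightarrow> 'o \<Rightarrow> 'o \<Rightarrow> 'a set" where
  "arrows C A B = {f \<in> Ar C. Dom C f = A \<and> Cod C f = B}"

locale dagger_category =
  fixes C :: "('o, 'a) dagcat"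
  assumes Dom_Ob: "f \<in> Ar C \<Longrightarrow> Dom C f \<in> Ob C"
    and Cod_Ob: "f \<in> Ar C \<Longrightarrow> Cod C f \<in> Ob C"
    and Ident_arrows: "A \<in> Ob C \<Longrightarrow> Ident C A \<in> arrows C A A"
    and Cmp_arrows: "\<lbrakk>f \<in> arrows C A B; g \<in> arrows C B D\<rbrakk> \<Longrightarrow> Cmp C g f \<in> arrows C A D"
    and Cmp_Ident_left: "f \<in> arrows C A B \<Longrightarrow> Cmp C (Ident C B) f = f"
    and Cmp_Ident_right: "f \<in> arrows C A B \<Longrightarrow> Cmp C f (Ident C A) = f"
    and Cmp_assoc: "\<lbrakk>f \<in> arrows C A B; g \<in> arrows C B D; h \<in> arrows C D E\<rbrakk>
      \<Longrightarrow> Cmp C h (Cmp C g f) = Cmp C (Cmp C h g) f"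
    and Dag_arrows: "f \<in> arrows C A B \<Longrightarrow> Dag C f \<in> arrows C B A"
    and Dag_Ident: "A \<in> Ob C \<Longrightarrow> Dag C (Ident C A) = Ident C A"
    and Dag_Cmp: "\<lbrakk>f \<in> arrows C A B; g \<in> arrows C B D\<rbrakk>
      \<Longrightarrow> Dag C (Cmp C g f) = Cmp C (Dag C f) (Dag C g)"
    and Dag_Dag: "f \<in> Ar C \<Longrightarrow> Dag C (Dag C f) = f"

record ('o, 'a, 'p, 'b) dagfun =
  FOb :: "'o \<Rightarrow> 'p"
  FAr :: "'a \<Rightarrow> 'b"

locale dagger_functor = C: dagger_category C + D: dagger_category D
  for C :: "('o, 'a) dagcat" and D :: "('p, 'b) dagcat" +
  fixes F :: "('o, 'a, 'p, 'b) dagfun"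
  assumes FOb_Ob: "A \<in> Ob C \<Longrightarrow> FOb F A \<in> Ob D"
    and FAr_arrows: "f \<in> arrows C A B \<Longrightarrow> FAr F f \<in> arrows D (FOb F A) (FOb F B)"
    and FAr_Ident: "A \<in> Ob C \<Longrightarrow> FAr F (Ident C A) = Ident D (FOb F A)"
    and FAr_Cmp: "\<lbrakk>f \<in> arrows C A B; g \<in> arrows C B E\<rbrakk>
      \<Longrightarrow> FAr F (Cmp C g f) = Cmp D (FAr F g) (FAr F f)"
    and FAr_Dag: "f \<in> Ar C \<Longrightarrow> FAr F (Dag C f) = Dag D (FAr F f)"

definition terminal_dagcat :: "(unit, unit) dagcat" where
  "terminal_dagcat =
    \<lparr>Ob = UNIV, Ar = UNIV, Dom = (\<lambda>_. ()), Cod = (\<lambda>_. ()), Ident = (\<lambda>_. ()),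
     Cmp = (\<lambda>_ _. ()), Dag = (\<lambda>_. ())\<rparr>"

definition prod_dagcat ::
    "('o, 'a) dagcat \<Rightarrow> ('p, 'b) dagcat \<Rightarrow> ('o \<times> 'p, 'a \<times> 'b) dagcat" where
  "prod_dagcat C D =
    \<lparr>Ob = Ob C \<times> Ob D, Ar = Ar C \<times> Ar D,
     Dom = map_prod (Dom C) (Dom D), Cod = map_prod (Cod C) (Cod D),
     Ident = map_prod (Ident C) (Ident D),
     Cmp = (\<lambda>(g, g') (f, f'). (Cmp C g f, Cmp D g' f')),
     Dag = map_prod (Dag C) (Dag D)\<rparr>"


section \<open>Dagger 2-categories\<close>

text \<open>
  A category enriched in dagger categories with respect to the cartesian product. The hom-objects
  are indexed by pairs of 0-cells, so 1-cells and 2-cells need not determine their 0-cell source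
  and target.
\<close>

record ('o, 'f, 't) dag2cat =
  Ob0 :: "'o set"
  Hom :: "'o \<Rightarrow> 'o \<Rightarrow> ('f, 't) dagcat"
  HComp :: "'o \<Rightarrow> 'o \<Rightarrow> 'o \<Rightarrow> ('f \<times> 'f, 't \<times> 't, 'f, 't) dagfun"
    \<comment> \<open>\<open>HComp K A B C : Hom K B C \<times> Hom K A B \<rightarrow> Hom K A C\<close>\<close>
  HUnit :: "'o \<Rightarrow> (unit, unit, 'f, 't) dagfun"

abbreviation comp1 :: "('o, 'f, 't) dag2cat \<Rightarrow> 'o \<Rightarrow> 'o \<Rightarrow> 'o \<Rightarrow> 'f \<Rightarrow> 'f \<Rightarrow> 'f" where
  "comp1 K A B C G F \<equiv> FOb (HComp K A B C) (G, F)"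

abbreviation id1 :: "('o, 'f, 't) dag2cat \<Rightarrow> 'o \<Rightarrow> 'f" where
  "id1 K A \<equiv> FOb (HUnit K A) ()"

abbreviation id2 :: "('o, 'f, 't) dag2cat \<Rightarrow> 'o \<Rightarrow> 'o \<Rightarrow> 'f \<Rightarrow> 't" where
  "id2 K A B \<equiv> Ident (Hom K A B)"

abbreviation vert :: "('o, 'f, 't) dag2cat \<Rightarrow> 'o \<Rightarrow> 'o \<Rightarrow> 't \<Rightarrow> 't \<Rightarrow> 't" where
  "vert K A B \<equiv> Cmp (Hom K A B)"

abbreviation dag2 :: "('o, 'f, 't) dag2cat \<Rightarrow> 'o \<Rightarrow> 'o \<Rightarrow> 't \<Rightarrow> 't" where
  "dag2 K A B \<equiv> Dag (Hom K A B)"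

abbreviation horiz :: "('o, 'f, 't) dag2cat \<Rightarrow> 'o \<Rightarrow> 'o \<Rightarrow> 'o \<Rightarrow> 't \<Rightarrow> 't \<Rightarrow> 't" where
  "horiz K A B C \<psi> \<phi> \<equiv> FAr (HComp K A B C) (\<psi>, \<phi>)"

text \<open>The whiskerings \<open>G\<phi>\<close> and \<open>\<psi>F\<close>, with \<open>\<phi>\<close>, \<open>F\<close> in \<open>Hom K A B\<close> and \<open>G\<close>, \<open>\<psi>\<close> in \<open>Hom K B C\<close>.\<close>

abbreviation lwh :: "('o, 'f, 't) dag2cat \<Rightarrow> 'o \<Rightarrow> 'o \<Rightarrow> 'o \<Rightarrow> 'f \<Rightarrow> 't \<Rightarrow> 't" where
  "lwh K A B C G \<phi> \<equiv> horiz K A B C (id2 K B C G) \<phi>"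

abbreviation rwh :: "('o, 'f, 't) dag2cat \<Rightarrow> 'o \<Rightarrow> 'o \<Rightarrow> 'o \<Rightarrow> 't \<Rightarrow> 'f \<Rightarrow> 't" where
  "rwh K A B C \<psi> F \<equiv> horiz K A B C \<psi> (id2 K A B F)"

locale dagger_2_category =
  fixes K :: "('o, 'f, 't) dag2cat"
  assumes Hom: "\<lbrakk>A \<in> Ob0 K; B \<in> Ob0 K\<rbrakk> \<Longrightarrow> dagger_category (Hom K A B)"
    and HComp: "\<lbrakk>A \<in> Ob0 K; B \<in> Ob0 K; C \<in> Ob0 K\<rbrakk>
      \<Longrightarrow> dagger_functor (prod_dagcat (Hom K B C) (Hom K A B)) (Hom K A C) (HComp K A B C)"
    and HUnit: "A \<in> Ob0 K \<Longrightarrow> dagger_functor terminal_dagcat (Hom K A A) (HUnit K A)"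
    and comp1_assoc: "\<lbrakk>A \<in> Ob0 K; B \<in> Ob0 K; C \<in> Ob0 K; D \<in> Ob0 K;
        F \<in> Ob (Hom K A B); G \<in> Ob (Hom K B C); H \<in> Ob (Hom K C D)\<rbrakk>
      \<Longrightarrow> comp1 K A C D H (comp1 K A B C G F) = comp1 K A B D (comp1 K B C D H G) F"
    and horiz_assoc: "\<lbrakk>A \<in> Ob0 K; B \<in> Ob0 K; C \<in> Ob0 K; D \<in> Ob0 K;
        \<phi> \<in> Ar (Hom K A B); \<psi> \<in> Ar (Hom K B C); \<chi> \<in> Ar (Hom K C D)\<rbrakk>
      \<Longrightarrow> horiz K A C D \<chi> (horiz K A B C \<psi> \<phi>) = horiz K A B D (horiz K B C D \<chi> \<psi>) \<phi>"
    and comp1_unit_left: "\<lbrakk>A \<in> Ob0 K; B \<in> Ob0 K; F \<in> Ob (Hom K A B)\<rbrakk>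
      \<Longrightarrow> comp1 K A B B (id1 K B) F = F"
    and comp1_unit_right: "\<lbrakk>A \<in> Ob0 K; B \<in> Ob0 K; F \<in> Ob (Hom K A B)\<rbrakk>
      \<Longrightarrow> comp1 K A A B F (id1 K A) = F"
    and horiz_unit_left: "\<lbrakk>A \<in> Ob0 K; B \<in> Ob0 K; \<phi> \<in> Ar (Hom K A B)\<rbrakk>
      \<Longrightarrow> horiz K A B B (FAr (HUnit K B) ()) \<phi> = \<phi>"
    and horiz_unit_right: "\<lbrakk>A \<in> Ob0 K; B \<in> Ob0 K; \<phi> \<in> Ar (Hom K A B)\<rbrakk>
      \<Longrightarrow> horiz K A A B \<phi> (FAr (HUnit K A) ()) = \<phi>"

record ('o, 'f, 't, 'p, 'g, 's) dag2fun =
  On0 :: "'o \<Rightarrow> 'p"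
  OnHom :: "'o \<Rightarrow> 'o \<Rightarrow> ('f, 't, 'g, 's) dagfun"

abbreviation on1 :: "('o, 'f, 't, 'p, 'g, 's) dag2fun \<Rightarrow> 'o \<Rightarrow> 'o \<Rightarrow> 'f \<Rightarrow> 'g" where
  "on1 P A B \<equiv> FOb (OnHom P A B)"

abbreviation on2 :: "('o, 'f, 't, 'p, 'g, 's) dag2fun \<Rightarrow> 'o \<Rightarrow> 'o \<Rightarrow> 't \<Rightarrow> 's" where
  "on2 P A B \<equiv> FAr (OnHom P A B)"

locale dagger_2_functor = K: dagger_2_category K + L: dagger_2_category L
  for K :: "('o, 'f, 't) dag2cat" and L :: "('p, 'g, 's) dag2cat" +
  fixes P :: "('o, 'f, 't, 'p, 'g, 's) dag2fun"
  assumes On0_Ob0: "A \<in> Ob0 K \<Longrightarrow> On0 P A \<in> Ob0 L"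
    and OnHom: "\<lbrakk>A \<in> Ob0 K; B \<in> Ob0 K\<rbrakk>
      \<Longrightarrow> dagger_functor (Hom K A B) (Hom L (On0 P A) (On0 P B)) (OnHom P A B)"
    and on1_comp1: "\<lbrakk>A \<in> Ob0 K; B \<in> Ob0 K; C \<in> Ob0 K; F \<in> Ob (Hom K A B); G \<in> Ob (Hom K B C)\<rbrakk>
      \<Longrightarrow> on1 P A C (comp1 K A B C G F)
        = comp1 L (On0 P A) (On0 P B) (On0 P C) (on1 P B C G) (on1 P A B F)"
    and on2_horiz: "\<lbrakk>A \<in> Ob0 K; B \<in> Ob0 K; C \<in> Ob0 K; \<phi> \<in> Ar (Hom K A B); \<psi> \<in> Ar (Hom K B C)\<rbrakk>
      \<Longrightarrow> on2 P A C (horiz K A B C \<psi> \<phi>)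
        = horiz L (On0 P A) (On0 P B) (On0 P C) (on2 P B C \<psi>) (on2 P A B \<phi>)"
    and on1_id1: "A \<in> Ob0 K \<Longrightarrow> on1 P A A (id1 K A) = id1 L (On0 P A)"
    and on2_unit: "A \<in> Ob0 K
      \<Longrightarrow> on2 P A A (FAr (HUnit K A) ()) = FAr (HUnit L (On0 P A)) ()"

definition id_2fun :: "('o, 'f, 't, 'o, 'f, 't) dag2fun" where
  "id_2fun = \<lparr>On0 = (\<lambda>A. A), OnHom = (\<lambda>_ _. \<lparr>FOb = (\<lambda>F. F), FAr = (\<lambda>\<phi>. \<phi>)\<rparr>)\<rparr>"

definition comp_2fun ::
    "('p, 'g, 's, 'q, 'h, 'r) dag2fun \<Rightarrow> ('o, 'f, 't, 'p, 'g, 's) dag2fun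
      \<Rightarrow> ('o, 'f, 't, 'q, 'h, 'r) dag2fun" where
  "comp_2fun Q P =
    \<lparr>On0 = (\<lambda>A. On0 Q (On0 P A)),
     OnHom = (\<lambda>A B. \<lparr>FOb = (\<lambda>F. on1 Q (On0 P A) (On0 P B) (on1 P A B F)),
                     FAr = (\<lambda>\<phi>. on2 Q (On0 P A) (On0 P B) (on2 P A B \<phi>))\<rparr>)\<rparr>"

locale two_natural_transformation = P: dagger_2_functor K L P + Q: dagger_2_functor K L Q
  for K :: "('o, 'f, 't) dag2cat" and L :: "('p, 'g, 's) dag2cat"
    and P Q :: "('o, 'f, 't, 'p, 'g, 's) dag2fun" +
  fixes \<alpha> :: "'o \<Rightarrow> 'g"
  assumes component: "A \<in> Ob0 K \<Longrightarrow> \<alpha> A \<in> Ob (Hom L (On0 P A) (On0 Q A))"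
    and natural1: "\<lbrakk>A \<in> Ob0 K; B \<in> Ob0 K; F \<in> Ob (Hom K A B)\<rbrakk>
      \<Longrightarrow> comp1 L (On0 P A) (On0 P B) (On0 Q B) (\<alpha> B) (on1 P A B F)
        = comp1 L (On0 P A) (On0 Q A) (On0 Q B) (on1 Q A B F) (\<alpha> A)"
    and natural2: "\<lbrakk>A \<in> Ob0 K; B \<in> Ob0 K; \<phi> \<in> Ar (Hom K A B)\<rbrakk>
      \<Longrightarrow> lwh L (On0 P A) (On0 P B) (On0 Q B) (\<alpha> B) (on2 P A B \<phi>)
        = rwh L (On0 P A) (On0 Q A) (On0 Q B) (on2 Q A B \<phi>) (\<alpha> A)"

text \<open>
  \<open>L\<close> is left adjoint to \<open>R\<close>: unit \<open>\<eta>\<close>, counit \<open>\<epsilon>\<close> and the (strict) triangle identities.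
\<close>

locale dagger_2_adjunction =
  L: dagger_2_functor K M L + R: dagger_2_functor M K R +
  unit: two_natural_transformation K K id_2fun "comp_2fun R L" \<eta> +
  counit: two_natural_transformation M M "comp_2fun L R" id_2fun \<epsilon>
  for K :: "('o, 'f, 't) dag2cat" and M :: "('p, 'g, 's) dag2cat"
    and L :: "('o, 'f, 't, 'p, 'g, 's) dag2fun" and R :: "('p, 'g, 's, 'o, 'f, 't) dag2fun"
    and \<eta> :: "'o \<Rightarrow> 'f" and \<epsilon> :: "'p \<Rightarrow> 'g" +
  assumes triangle_left: "A \<in> Ob0 K
      \<Longrightarrow> comp1 M (On0 L A) (On0 L (On0 R (On0 L A))) (On0 L A)
            (\<epsilon> (On0 L A)) (on1 L A (On0 R (On0 L A)) (\<eta> A))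
        = id1 M (On0 L A)"
    and triangle_right: "X \<in> Ob0 M
      \<Longrightarrow> comp1 K (On0 R X) (On0 R (On0 L (On0 R X))) (On0 R X)
            (on1 R (On0 L (On0 R X)) X (\<epsilon> X)) (\<eta> (On0 R X))
        = id1 K (On0 R X)"

definition has_right_adjoint ::
    "('o, 'f, 't) dag2cat \<Rightarrow> ('p, 'g, 's) dag2cat \<Rightarrow> ('o, 'f, 't, 'p, 'g, 's) dag2fun \<Rightarrow> bool" where
  "has_right_adjoint K M L \<longleftrightarrow> (\<exists>R \<eta> \<epsilon>. dagger_2_adjunction K M L R \<eta> \<epsilon>)"


section \<open>The dagger 2-category of dagger Frobenius monads\<close>

record ('o, 'f, 't) dfmonad =
  Base :: 'o
  Endo :: 'f
  Unt :: 't
  Mult :: 't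

definition dagger_frobenius_monad :: "('o, 'f, 't) dag2cat \<Rightarrow> ('o, 'f, 't) dfmonad \<Rightarrow> bool" where
  "dagger_frobenius_monad K X \<longleftrightarrow>
    (let C = Base X; T = Endo X; \<eta> = Unt X; \<mu> = Mult X; TT = comp1 K C C C T T in
      C \<in> Ob0 K \<and> T \<in> Ob (Hom K C C) \<and>
      \<eta> \<in> arrows (Hom K C C) (id1 K C) T \<and>
      \<mu> \<in> arrows (Hom K C C) TT T \<and>
      vert K C C \<mu> (lwh K C C C T \<mu>) = vert K C C \<mu> (rwh K C C C \<mu> T) \<and>
      vert K C C \<mu> (lwh K C C C T \<eta>) = id2 K C C T \<and>
      vert K C C \<mu> (rwh K C C C \<eta> T) = id2 K C C T \<and>
      vert K C C (rwh K C C C \<mu> T) (lwh K C C C T (dag2 K C C \<mu>))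
        = vert K C C (lwh K C C C T \<mu>) (rwh K C C C (dag2 K C C \<mu>) T))"

definition dfm_morphism ::
    "('o, 'f, 't) dag2cat \<Rightarrow> ('o, 'f, 't) dfmonad \<Rightarrow> ('o, 'f, 't) dfmonad \<Rightarrow> 'f \<times> 't \<Rightarrow> bool" where
  "dfm_morphism K X Y = (\<lambda>(F, \<sigma>).
    let C = Base X; S = Endo X; D = Base Y; T = Endo Y in
      F \<in> Ob (Hom K C D) \<and>
      \<sigma> \<in> arrows (Hom K C D) (comp1 K C D D T F) (comp1 K C C D F S) \<and>
      vert K C D \<sigma> (rwh K C D D (Unt Y) F) = lwh K C C D F (Unt X) \<and>
      vert K C D \<sigma> (rwh K C D D (Mult Y) F)
        = vert K C D (lwh K C C D F (Mult X))
            (vert K C D (rwh K C C D \<sigma> S) (lwh K C D D T \<sigma>)) \<and>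
      vert K C D (dag2 K C D \<sigma>) (vert K C D (lwh K C C D F (Mult X)) (rwh K C C D \<sigma> S))
        = vert K C D (rwh K C D D (Mult Y) F) (lwh K C D D T (dag2 K C D \<sigma>)))"

definition dfm_transformation ::
    "('o, 'f, 't) dag2cat \<Rightarrow> ('o, 'f, 't) dfmonad \<Rightarrow> ('o, 'f, 't) dfmonad
      \<Rightarrow> 'f \<times> 't \<Rightarrow> 'f \<times> 't \<Rightarrow> 't \<Rightarrow> bool" where
  "dfm_transformation K X Y = (\<lambda>(F, \<sigma>) (G, \<tau>) \<phi>.
    let C = Base X; S = Endo X; D = Base Y; T = Endo Y in
      \<phi> \<in> arrows (Hom K C D) F G \<and>
      vert K C D \<tau> (lwh K C D D T \<phi>) = vert K C D (rwh K C C D \<phi> S) \<sigma> \<and>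
      vert K C D \<sigma> (lwh K C D D T (dag2 K C D \<phi>)) = vert K C D (rwh K C C D (dag2 K C D \<phi>) S) \<tau>)"

text \<open>
  A 2-cell of \<open>K\<close> may be a transformation between several pairs of monad morphisms, so it is tagged
  with its source and target morphisms.
\<close>

definition DFMonad_hom ::
    "('o, 'f, 't) dag2cat \<Rightarrow> ('o, 'f, 't) dfmonad \<Rightarrow> ('o, 'f, 't) dfmonad
      \<Rightarrow> ('f \<times> 't, ('f \<times> 't) \<times> ('f \<times> 't) \<times> 't) dagcat" where
  "DFMonad_hom K X Y =
    \<lparr>Ob = {m. dfm_morphism K X Y m},
     Ar = {(m, n, \<phi>). dfm_morphism K X Y m \<and> dfm_morphism K X Y n \<and> dfm_transformation K X Y m n \<phi>},
     Dom = (\<lambda>(m, n, \<phi>). m),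
     Cod = (\<lambda>(m, n, \<phi>). n),
     Ident = (\<lambda>m. (m, m, id2 K (Base X) (Base Y) (fst m))),
     Cmp = (\<lambda>(n, p, \<psi>) (m, n', \<phi>). (m, p, vert K (Base X) (Base Y) \<psi> \<phi>)),
     Dag = (\<lambda>(m, n, \<phi>). (n, m, dag2 K (Base X) (Base Y) \<phi>))\<rparr>"

definition dfm_comp ::
    "('o, 'f, 't) dag2cat \<Rightarrow> ('o, 'f, 't) dfmonad \<Rightarrow> ('o, 'f, 't) dfmonad \<Rightarrow> ('o, 'f, 't) dfmonad
      \<Rightarrow> 'f \<times> 't \<Rightarrow> 'f \<times> 't \<Rightarrow> 'f \<times> 't" where
  "dfm_comp K X Y Z = (\<lambda>(G, \<tau>) (F, \<sigma>).
    let A = Base X; B = Base Y; C = Base Z in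
      (comp1 K A B C G F, vert K A C (lwh K A B C G \<sigma>) (rwh K A B C \<tau> F)))"

definition dfm_id :: "('o, 'f, 't) dag2cat \<Rightarrow> ('o, 'f, 't) dfmonad \<Rightarrow> 'f \<times> 't" where
  "dfm_id K X = (id1 K (Base X), id2 K (Base X) (Base X) (Endo X))"

definition DFMonad ::
    "('o, 'f, 't) dag2cat
      \<Rightarrow> (('o, 'f, 't) dfmonad, 'f \<times> 't, ('f \<times> 't) \<times> ('f \<times> 't) \<times> 't) dag2cat" where
  "DFMonad K =
    \<lparr>Ob0 = {X. dagger_frobenius_monad K X},
     Hom = DFMonad_hom K,
     HComp = (\<lambda>X Y Z.
       \<lparr>FOb = (\<lambda>(n, m). dfm_comp K X Y Z n m),
        FAr = (\<lambda>((n, n', \<psi>), (m, m', \<phi>)).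
          (dfm_comp K X Y Z n m, dfm_comp K X Y Z n' m',
           horiz K (Base X) (Base Y) (Base Z) \<psi> \<phi>))\<rparr>),
     HUnit = (\<lambda>X.
       \<lparr>FOb = (\<lambda>_. dfm_id K X),
        FAr = (\<lambda>_. (dfm_id K X, dfm_id K X, id2 K (Base X) (Base X) (id1 K (Base X))))\<rparr>)\<rparr>"

definition DFMonad_inclusion ::
    "('o, 'f, 't) dag2cat
      \<Rightarrow> ('o, 'f, 't, ('o, 'f, 't) dfmonad, 'f \<times> 't, ('f \<times> 't) \<times> ('f \<times> 't) \<times> 't) dag2fun" where
  "DFMonad_inclusion K =
    \<lparr>On0 = (\<lambda>C.
       \<lparr>Base = C, Endo = id1 K C, Unt = id2 K C C (id1 K C), Mult = id2 K C C (id1 K C)\<rparr>),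
     OnHom = (\<lambda>C D.
       let incl = (\<lambda>F. (F, id2 K C D F)) in
         \<lparr>FOb = incl,
          FAr = (\<lambda>\<psi>. (incl (Dom (Hom K C D) \<psi>), incl (Cod (Hom K C D) \<psi>), \<psi>))\<rparr>)\<rparr>"

definition admits_FEM_algebras :: "('o, 'f, 't) dag2cat \<Rightarrow> bool" where
  "admits_FEM_algebras K \<longleftrightarrow>
    dagger_2_category K \<and> has_right_adjoint K (DFMonad K) (DFMonad_inclusion K)"


section \<open>The dagger 2-category of small dagger categories\<close>

text \<open>
  A notion of smallness for subsets of a type \<open>'u\<close> whose elements serve as the objects and arrows
  of small categories. The closure properties are deliberately fewer than those of a universe of
  sets (no power sets or unions), so that both the elements of a Grothendieck universe \<open>'u\<close> and the
  case where every subset of an infinite type \<open>'u\<close> is small are covered. Closure under subsets and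
  images is the condition on \<open>\<lesssim>\<close>.
\<close>

definition smallness :: "('u set \<Rightarrow> bool) \<Rightarrow> bool" where
  "smallness small \<longleftrightarrow>
    infinite (UNIV :: 'u set) \<and> (\<forall>A. finite A \<longrightarrow> small A) \<and>
    (\<forall>A B. small A \<longrightarrow> B \<lesssim> A \<longrightarrow> small B) \<and>
    (\<forall>A B. small A \<longrightarrow> small B \<longrightarrow> (\<exists>P. small P \<and> P \<approx> A \<times> B))"

text \<open>
  In each of the following three notions, functions take the value \<^const>\<open>undefined\<close> outside their
  domain, so that equality in HOL is equality of small dagger categories, of dagger functors and of
  natural transformations.
\<close>

definition small_dagger_category :: "('u set \<Rightarrow> bool) \<Rightarrow> ('u, 'u) dagcat \<Rightarrow> bool" where
  "small_dagger_category small C \<longleftrightarrow>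
    dagger_category C \<and> small (Ob C) \<and> small (Ar C) \<and>
    Dom C \<in> extensional (Ar C) \<and> Cod C \<in> extensional (Ar C) \<and>
    Ident C \<in> extensional (Ob C) \<and> Dag C \<in> extensional (Ar C) \<and>
    (\<forall>g f. \<not> (g \<in> Ar C \<and> f \<in> Ar C \<and> Dom C g = Cod C f) \<longrightarrow> Cmp C g f = undefined)"

definition dagger_functors ::
    "('o, 'a) dagcat \<Rightarrow> ('p, 'b) dagcat \<Rightarrow> ('o, 'a, 'p, 'b) dagfun set" where
  "dagger_functors C D =
    {F. dagger_functor C D F \<and> FOb F \<in> extensional (Ob C) \<and> FAr F \<in> extensional (Ar C)}"

definition natural_transformation ::
    "('o, 'a) dagcat \<Rightarrow> ('p, 'b) dagcat \<Rightarrow> ('o, 'a, 'p, 'b) dagfun \<Rightarrow> ('o, 'a, 'p, 'b) dagfun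
      \<Rightarrow> ('o \<Rightarrow> 'b) \<Rightarrow> bool" where
  "natural_transformation C D F G \<alpha> \<longleftrightarrow>
    \<alpha> \<in> extensional (Ob C) \<and>
    (\<forall>A\<in>Ob C. \<alpha> A \<in> arrows D (FOb F A) (FOb G A)) \<and>
    (\<forall>f\<in>Ar C. Cmp D (\<alpha> (Cod C f)) (FAr F f) = Cmp D (FAr G f) (\<alpha> (Dom C f)))"

definition dagfun_id :: "('o, 'a) dagcat \<Rightarrow> ('o, 'a, 'o, 'a) dagfun" where
  "dagfun_id C = \<lparr>FOb = restrict (\<lambda>A. A) (Ob C), FAr = restrict (\<lambda>f. f) (Ar C)\<rparr>"

definition dagfun_comp ::
    "('o, 'a) dagcat \<Rightarrow> ('p, 'b, 'q, 'c) dagfun \<Rightarrow> ('o, 'a, 'p, 'b) dagfun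
      \<Rightarrow> ('o, 'a, 'q, 'c) dagfun" where
  "dagfun_comp C G F =
    \<lparr>FOb = compose (Ob C) (FOb G) (FOb F), FAr = compose (Ar C) (FAr G) (FAr F)\<rparr>"

type_synonym ('o, 'a, 'p, 'b) nattrans =
  "('o, 'a, 'p, 'b) dagfun \<times> ('o, 'a, 'p, 'b) dagfun \<times> ('o \<Rightarrow> 'b)"

definition functor_dagcat ::
    "('o, 'a) dagcat \<Rightarrow> ('p, 'b) dagcat
      \<Rightarrow> (('o, 'a, 'p, 'b) dagfun, ('o, 'a, 'p, 'b) nattrans) dagcat" where
  "functor_dagcat C D =
    \<lparr>Ob = dagger_functors C D,
     Ar = {(F, G, \<alpha>). F \<in> dagger_functors C D \<and> G \<in> dagger_functors C D \<and>
                      natural_transformation C D F G \<alpha>},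
     Dom = (\<lambda>(F, G, \<alpha>). F),
     Cod = (\<lambda>(F, G, \<alpha>). G),
     Ident = (\<lambda>F. (F, F, \<lambda>A\<in>Ob C. Ident D (FOb F A))),
     Cmp = (\<lambda>(G, H, \<beta>) (F, G', \<alpha>). (F, H, \<lambda>A\<in>Ob C. Cmp D (\<beta> A) (\<alpha> A))),
     Dag = (\<lambda>(F, G, \<alpha>). (G, F, \<lambda>A\<in>Ob C. Dag D (\<alpha> A)))\<rparr>"

definition DagCat ::
    "('u set \<Rightarrow> bool)
      \<Rightarrow> (('u, 'u) dagcat, ('u, 'u, 'u, 'u) dagfun, ('u, 'u, 'u, 'u) nattrans) dag2cat" where
  "DagCat small =
    \<lparr>Ob0 = {C. small_dagger_category small C},
     Hom = functor_dagcat,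
     HComp = (\<lambda>C D E.
       \<lparr>FOb = (\<lambda>(G, F). dagfun_comp C G F),
        FAr = (\<lambda>((G, G', \<beta>), (F, F', \<alpha>)).
          (dagfun_comp C G F, dagfun_comp C G' F',
           \<lambda>A\<in>Ob C. Cmp E (\<beta> (FOb F' A)) (FAr G (\<alpha> A))))\<rparr>),
     HUnit = (\<lambda>C.
       \<lparr>FOb = (\<lambda>_. dagfun_id C),
        FAr = (\<lambda>_. (dagfun_id C, dagfun_id C, \<lambda>A\<in>Ob C. Ident C A))\<rparr>)\<rparr>"

end

theory Submission
  imports Defs
begin

text \<open>
  For a dagger Frobenius monad \<open>X = (C, T)\<close>, the FEM-algebras are the Eilenberg-Moore algebras
  \<open>a : T A \<rightarrow> A\<close> with \<open>a\<^sup>\<dagger> a = \<mu> (T a\<^sup>\<dagger>)\<close>, and their morphisms are the algebra homomorphisms whose dagger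
  is a homomorphism as well. A monad morphism \<open>(F, \<sigma>)\<close> from an included dagger category \<open>A\<close> to \<open>X\<close>
  is, pointwise, a functor \<open>F\<close> together with an FEM-algebra structure \<open>\<sigma>\<close> on each of its values, natural in
  the argument; that is, it factors uniquely through the forgetful functor of the category of
  FEM-algebras, with the tautological structure maps. So this forgetful functor is a universal
  arrow from the inclusion to \<open>X\<close>, for 1-cells and 2-cells alike, and a family of such universal
  arrows makes the choice of their sources a right adjoint.
\<close>

section \<open>Dagger categories and 2-categories\<close>

text \<open>The law on \<open>a\<^sup>\<dagger> a\<close> is condition (3) on monad morphisms when
  the source is an identity monad: it becomes \<open>\<sigma>\<^sup>\<dagger> \<sigma> = (\<mu> F)
  (T \<sigma>\<^sup>\<dagger>)\<close>. Its left side is self-adjoint, so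
  \<open>\<mu> (T a\<^sup>\<dagger>)\<close> equals its own dagger
  \<open>(T a) \<mu>\<^sup>\<dagger>\<close>, which is the more familiar Frobenius law for algebras.
  Two obstacles shape the proof. All 0-cells of \<open>DagCat small\<close> have objects and arrows
  in one fixed type, but an arrow between algebras is a triple of source, target and underlying
  arrow. A structure map determines its carrier and can serve as an object directly; the triples are
  coded by an injection that exists because the type is infinite, and closure of smallness under
  images and products keeps the result a 0-cell. Secondly, the adjunction is strict. Since functors
  and families are extensional, composition with the counit can be shown bijective on the nose, on
  objects and on arrows of hom-categories. Functoriality of the adjoint and the remaining laws then
  follow from defining equations or by cancelling the counit.\<close>

context dagger_category
begin

lemma Cmp_closed:
  assumes "f \<in> Ar C" "g \<in> Ar C" "Dom C g = Cod C f"
  shows Cmp_Ar: "Cmp C g f \<in> Ar C"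
    and Dom_Cmp: "Dom C (Cmp C g f) = Dom C f"
    and Cod_Cmp: "Cod C (Cmp C g f) = Cod C g"
  using Cmp_arrows[of f "Dom C f" "Cod C f" g "Cod C g"] assms by (auto simp: arrows_def)

lemma Ident_closed:
  assumes "A \<in> Ob C"
  shows Ident_Ar: "Ident C A \<in> Ar C"
    and Dom_Ident: "Dom C (Ident C A) = A"
    and Cod_Ident: "Cod C (Ident C A) = A"
  using Ident_arrows[OF assms] by (auto simp: arrows_def)

lemma Dag_closed:
  assumes "f \<in> Ar C"
  shows Dag_Ar: "Dag C f \<in> Ar C"
    and Dom_Dag: "Dom C (Dag C f) = Cod C f"
    and Cod_Dag: "Cod C (Dag C f) = Dom C f"
  using Dag_arrows[of f "Dom C f" "Cod C f"] assms by (auto simp: arrows_def)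

lemma Cmp_Ident_Cod: "\<lbrakk>f \<in> Ar C; Cod C f = B\<rbrakk> \<Longrightarrow> Cmp C (Ident C B) f = f"
  by (rule Cmp_Ident_left[of f "Dom C f"]) (simp add: arrows_def)

lemma Cmp_Ident_Dom: "\<lbrakk>f \<in> Ar C; Dom C f = A\<rbrakk> \<Longrightarrow> Cmp C f (Ident C A) = f"
  by (rule Cmp_Ident_right[of f _ "Cod C f"]) (simp add: arrows_def)

lemma Cmp_Cmp:
  assumes "f \<in> Ar C" "g \<in> Ar C" "h \<in> Ar C" "Dom C g = Cod C f" "Dom C h = Cod C g"
  shows "Cmp C (Cmp C h g) f = Cmp C h (Cmp C g f)"
  using Cmp_assoc[of f "Dom C f" "Cod C f" g "Cod C g" h "Cod C h"] assms
  by (simp add: arrows_def)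

lemma Dag_of_Cmp:
  assumes "f \<in> Ar C" "g \<in> Ar C" "Dom C g = Cod C f"
  shows "Dag C (Cmp C g f) = Cmp C (Dag C f) (Dag C g)"
  using Dag_Cmp[of f "Dom C f" "Cod C f" g "Cod C g"] assms by (simp add: arrows_def)

text \<open>Composability is phrased by equations between \<open>Dom\<close> and \<open>Cod\<close>
  instead of membership in \<open>arrows\<close>, so that the simplifier can discharge it;
  composites are normalized to nest on the right and daggers are pushed inwards.\<close>

lemmas cat_simps =
  Dom_Ob Cod_Ob Cmp_Ar Dom_Cmp Cod_Cmp Ident_Ar Dom_Ident Cod_Ident Dag_Ar Dom_Dag Cod_Dag
  Cmp_Ident_Cod Cmp_Ident_Dom Cmp_Cmp Dag_Ident Dag_of_Cmp Dag_Dag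

end

context dagger_functor
begin

lemma FAr_closed:
  assumes "f \<in> Ar C"
  shows FAr_Ar: "FAr F f \<in> Ar D"
    and Dom_FAr: "Dom D (FAr F f) = FOb F (Dom C f)"
    and Cod_FAr: "Cod D (FAr F f) = FOb F (Cod C f)"
  using FAr_arrows[of f "Dom C f" "Cod C f"] assms by (auto simp: arrows_def)

lemma FAr_of_Cmp:
  assumes "f \<in> Ar C" "g \<in> Ar C" "Dom C g = Cod C f"
  shows "FAr F (Cmp C g f) = Cmp D (FAr F g) (FAr F f)"
  using FAr_Cmp[of f "Dom C f" "Cod C f" g "Cod C g"] assms by (simp add: arrows_def)

lemmas functor_simps = FOb_Ob FAr_Ar Dom_FAr Cod_FAr FAr_Ident FAr_of_Cmp FAr_Dag

end

lemma dagger_category_prod: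
  assumes "dagger_category C" "dagger_category D"
  shows "dagger_category (prod_dagcat C D)"
proof -
  interpret C: dagger_category C by fact
  interpret D: dagger_category D by fact
  show ?thesis
    by unfold_locales
      (auto simp: prod_dagcat_def arrows_def C.cat_simps D.cat_simps)
qed

section \<open>Calculus of 2-cells: whiskering, interchange and units\<close>

context dagger_2_category
begin

lemmas hom_simps [simp] = dagger_category.cat_simps[OF Hom]

lemma comp1_Ob [simp]:
  "\<lbrakk>A \<in> Ob0 K; B \<in> Ob0 K; C \<in> Ob0 K; F \<in> Ob (Hom K A B); G \<in> Ob (Hom K B C)\<rbrakk>
    \<Longrightarrow> comp1 K A B C G F \<in> Ob (Hom K A C)"
  by (rule dagger_functor.FOb_Ob[OF HComp]) (auto simp: prod_dagcat_def)

lemma horiz_closed [simp]: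
  assumes "A \<in> Ob0 K" "B \<in> Ob0 K" "C \<in> Ob0 K" "\<phi> \<in> Ar (Hom K A B)" "\<psi> \<in> Ar (Hom K B C)"
  shows horiz_Ar: "horiz K A B C \<psi> \<phi> \<in> Ar (Hom K A C)"
    and Dom_horiz: "Dom (Hom K A C) (horiz K A B C \<psi> \<phi>)
      = comp1 K A B C (Dom (Hom K B C) \<psi>) (Dom (Hom K A B) \<phi>)"
    and Cod_horiz: "Cod (Hom K A C) (horiz K A B C \<psi> \<phi>)
      = comp1 K A B C (Cod (Hom K B C) \<psi>) (Cod (Hom K A B) \<phi>)"
    and dag2_horiz: "dag2 K A C (horiz K A B C \<psi> \<phi>)
      = horiz K A B C (dag2 K B C \<psi>) (dag2 K A B \<phi>)"
  using dagger_functor.FAr_closed[OF HComp, of A B C "(\<psi>, \<phi>)"]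
    dagger_functor.FAr_Dag[OF HComp, of A B C "(\<psi>, \<phi>)"] assms
  by (auto simp: prod_dagcat_def)

lemma horiz_id2:
  assumes "A \<in> Ob0 K" "B \<in> Ob0 K" "C \<in> Ob0 K" "F \<in> Ob (Hom K A B)" "G \<in> Ob (Hom K B C)"
  shows "horiz K A B C (id2 K B C G) (id2 K A B F) = id2 K A C (comp1 K A B C G F)"
  using dagger_functor.FAr_Ident[OF HComp, of A B C "(G, F)"] assms
  by (auto simp: prod_dagcat_def)

text \<open>The interchange law is functoriality of \<open>HComp\<close> at a composite of
  pairs.\<close>

lemma horiz_vert:
  assumes "A \<in> Ob0 K" "B \<in> Ob0 K" "C \<in> Ob0 K"
    and "\<phi> \<in> Ar (Hom K A B)" "\<phi>' \<in> Ar (Hom K A B)" "Dom (Hom K A B) \<phi>' = Cod (Hom K A B) \<phi>"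
    and "\<psi> \<in> Ar (Hom K B C)" "\<psi>' \<in> Ar (Hom K B C)" "Dom (Hom K B C) \<psi>' = Cod (Hom K B C) \<psi>"
  shows "horiz K A B C (vert K B C \<psi>' \<psi>) (vert K A B \<phi>' \<phi>)
    = vert K A C (horiz K A B C \<psi>' \<phi>') (horiz K A B C \<psi> \<phi>)"
  using dagger_functor.FAr_of_Cmp[OF HComp, of A B C "(\<psi>, \<phi>)" "(\<psi>', \<phi>')"] assms
  by (auto simp: prod_dagcat_def)

lemma lwh_vert:
  assumes "A \<in> Ob0 K" "B \<in> Ob0 K" "C \<in> Ob0 K" "G \<in> Ob (Hom K B C)"
    and "\<phi> \<in> Ar (Hom K A B)" "\<phi>' \<in> Ar (Hom K A B)" "Dom (Hom K A B) \<phi>' = Cod (Hom K A B) \<phi>"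
  shows "lwh K A B C G (vert K A B \<phi>' \<phi>) = vert K A C (lwh K A B C G \<phi>') (lwh K A B C G \<phi>)"
  using horiz_vert[of A B C \<phi> \<phi>' "id2 K B C G" "id2 K B C G"] assms by simp

lemma rwh_vert:
  assumes "A \<in> Ob0 K" "B \<in> Ob0 K" "C \<in> Ob0 K" "F \<in> Ob (Hom K A B)"
    and "\<psi> \<in> Ar (Hom K B C)" "\<psi>' \<in> Ar (Hom K B C)" "Dom (Hom K B C) \<psi>' = Cod (Hom K B C) \<psi>"
  shows "rwh K A B C (vert K B C \<psi>' \<psi>) F = vert K A C (rwh K A B C \<psi>' F) (rwh K A B C \<psi> F)"
  using horiz_vert[of A B C "id2 K A B F" "id2 K A B F" \<psi> \<psi>'] assms by simp

text \<open>Interchange against identities. Together with \<open>vert_rwh_lwh\<close> it says that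
  two whiskered 2-cells may be applied in either order, which is the only use of interchange in the
  monad calculations.\<close>

lemma vert_lwh_rwh:
  assumes "A \<in> Ob0 K" "B \<in> Ob0 K" "C \<in> Ob0 K" "\<phi> \<in> Ar (Hom K A B)" "\<psi> \<in> Ar (Hom K B C)"
    and "Dom (Hom K A B) \<phi> = F" "Cod (Hom K B C) \<psi> = G"
  shows "vert K A C (lwh K A B C G \<phi>) (rwh K A B C \<psi> F) = horiz K A B C \<psi> \<phi>"
  using horiz_vert[of A B C "id2 K A B F" \<phi> \<psi> "id2 K B C G"] assms by auto

lemma vert_rwh_lwh:
  assumes "A \<in> Ob0 K" "B \<in> Ob0 K" "C \<in> Ob0 K" "\<phi> \<in> Ar (Hom K A B)" "\<psi> \<in> Ar (Hom K B C)"
    and "Cod (Hom K A B) \<phi> = F" "Dom (Hom K B C) \<psi> = G"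
  shows "vert K A C (rwh K A B C \<psi> F) (lwh K A B C G \<phi>) = horiz K A B C \<psi> \<phi>"
  using horiz_vert[of A B C \<phi> "id2 K A B F" "id2 K B C G" \<psi>] assms by auto

lemma id1_Ob [simp]: "A \<in> Ob0 K \<Longrightarrow> id1 K A \<in> Ob (Hom K A A)"
  by (rule dagger_functor.FOb_Ob[OF HUnit]) (auto simp: terminal_dagcat_def)

lemma HUnit_id2: "A \<in> Ob0 K \<Longrightarrow> FAr (HUnit K A) () = id2 K A A (id1 K A)"
  using dagger_functor.FAr_Ident[OF HUnit, of A "()"] by (simp add: terminal_dagcat_def)

lemma rwh_id2_id1 [simp]:
  "\<lbrakk>A \<in> Ob0 K; B \<in> Ob0 K; \<phi> \<in> Ar (Hom K A B)\<rbrakk> \<Longrightarrow> rwh K A A B \<phi> (id1 K A) = \<phi>"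
  using horiz_unit_right[of A B \<phi>] by (simp add: HUnit_id2)

lemma lwh_id1 [simp]:
  "\<lbrakk>A \<in> Ob0 K; B \<in> Ob0 K; \<phi> \<in> Ar (Hom K A B)\<rbrakk> \<Longrightarrow> lwh K A B B (id1 K B) \<phi> = \<phi>"
  using horiz_unit_left[of A B \<phi>] by (simp add: HUnit_id2)

lemmas comp1_unit [simp] = comp1_unit_left comp1_unit_right

end

section \<open>Dagger Frobenius monads\<close>

lemma dfm_morphism_iff:
  "dfm_morphism K X Y (F, \<sigma>) \<longleftrightarrow>
    F \<in> Ob (Hom K (Base X) (Base Y)) \<and> \<sigma> \<in> Ar (Hom K (Base X) (Base Y)) \<and>
    Dom (Hom K (Base X) (Base Y)) \<sigma> = comp1 K (Base X) (Base Y) (Base Y) (Endo Y) F \<and>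
    Cod (Hom K (Base X) (Base Y)) \<sigma> = comp1 K (Base X) (Base X) (Base Y) F (Endo X) \<and>
    vert K (Base X) (Base Y) \<sigma> (rwh K (Base X) (Base Y) (Base Y) (Unt Y) F)
      = lwh K (Base X) (Base X) (Base Y) F (Unt X) \<and>
    vert K (Base X) (Base Y) \<sigma> (rwh K (Base X) (Base Y) (Base Y) (Mult Y) F)
      = vert K (Base X) (Base Y) (lwh K (Base X) (Base X) (Base Y) F (Mult X))
          (vert K (Base X) (Base Y) (rwh K (Base X) (Base X) (Base Y) \<sigma> (Endo X))
            (lwh K (Base X) (Base Y) (Base Y) (Endo Y) \<sigma>)) \<and>
    vert K (Base X) (Base Y) (dag2 K (Base X) (Base Y) \<sigma>)
        (vert K (Base X) (Base Y) (lwh K (Base X) (Base X) (Base Y) F (Mult X))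
          (rwh K (Base X) (Base X) (Base Y) \<sigma> (Endo X)))
      = vert K (Base X) (Base Y) (rwh K (Base X) (Base Y) (Base Y) (Mult Y) F)
          (lwh K (Base X) (Base Y) (Base Y) (Endo Y) (dag2 K (Base X) (Base Y) \<sigma>))"
  by (auto simp: dfm_morphism_def arrows_def Let_def)

text \<open>A transformation satisfies this square twice, for \<open>\<phi>\<close> and, with
  \<open>\<sigma>\<close> and \<open>\<tau>\<close> exchanged, for its dagger. Isolating one square
  means that each closure property is proved once.\<close>

definition dfm_square where
  "dfm_square K X Y \<sigma> \<tau> \<phi> \<longleftrightarrow>
    vert K (Base X) (Base Y) \<tau> (lwh K (Base X) (Base Y) (Base Y) (Endo Y) \<phi>)
      = vert K (Base X) (Base Y) (rwh K (Base X) (Base X) (Base Y) \<phi> (Endo X)) \<sigma>"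

lemma dfm_transformation_iff:
  "dfm_transformation K X Y m n \<phi> \<longleftrightarrow>
    \<phi> \<in> Ar (Hom K (Base X) (Base Y)) \<and>
    Dom (Hom K (Base X) (Base Y)) \<phi> = fst m \<and> Cod (Hom K (Base X) (Base Y)) \<phi> = fst n \<and>
    dfm_square K X Y (snd m) (snd n) \<phi> \<and>
    dfm_square K X Y (snd n) (snd m) (dag2 K (Base X) (Base Y) \<phi>)"
  by (auto simp: dfm_transformation_def arrows_def Let_def dfm_square_def split: prod.splits)

section \<open>Monad morphisms and transformations: identities, composites, pasting\<close>

context dagger_2_category
begin

lemma dfm_cells [simp]:
  assumes "dagger_frobenius_monad K X"
  shows "Base X \<in> Ob0 K"
    and "Endo X \<in> Ob (Hom K (Base X) (Base X))"
    and "Unt X \<in> Ar (Hom K (Base X) (Base X))"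
    and "Dom (Hom K (Base X) (Base X)) (Unt X) = id1 K (Base X)"
    and "Cod (Hom K (Base X) (Base X)) (Unt X) = Endo X"
    and "Mult X \<in> Ar (Hom K (Base X) (Base X))"
    and "Dom (Hom K (Base X) (Base X)) (Mult X)
      = comp1 K (Base X) (Base X) (Base X) (Endo X) (Endo X)"
    and "Cod (Hom K (Base X) (Base X)) (Mult X) = Endo X"
  using assms by (auto simp: dagger_frobenius_monad_def Let_def arrows_def)

lemmas comp1_comp1 = comp1_assoc[symmetric]

lemmas whisker_simps = lwh_vert rwh_vert comp1_comp1 horiz_assoc[symmetric] horiz_id2[symmetric]

text \<open>With \<open>rwh_comp1\<close> and \<open>rwh_lwh\<close> this brings iterated
  whiskerings to a normal form: one 1-cell at a time, the left whiskerings outermost.\<close>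

lemma lwh_comp1:
  assumes "A \<in> Ob0 K" "B \<in> Ob0 K" "C \<in> Ob0 K" "D \<in> Ob0 K"
    and "\<phi> \<in> Ar (Hom K A B)" "G \<in> Ob (Hom K B C)" "H \<in> Ob (Hom K C D)"
  shows "lwh K A B D (comp1 K B C D H G) \<phi> = lwh K A C D H (lwh K A B C G \<phi>)"
  using assms by (simp add: whisker_simps)

lemma rwh_comp1:
  assumes "A \<in> Ob0 K" "B \<in> Ob0 K" "C \<in> Ob0 K" "D \<in> Ob0 K"
    and "F \<in> Ob (Hom K A B)" "G \<in> Ob (Hom K B C)" "\<psi> \<in> Ar (Hom K C D)"
  shows "rwh K A C D \<psi> (comp1 K A B C G F) = rwh K A B D (rwh K B C D \<psi> G) F"
  using assms by (simp add: whisker_simps)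

lemma rwh_lwh:
  assumes "A \<in> Ob0 K" "B \<in> Ob0 K" "C \<in> Ob0 K" "D \<in> Ob0 K"
    and "F \<in> Ob (Hom K A B)" "\<psi> \<in> Ar (Hom K B C)" "H \<in> Ob (Hom K C D)"
  shows "rwh K A B D (lwh K B C D H \<psi>) F = lwh K A C D H (rwh K A B C \<psi> F)"
  using assms by (simp add: whisker_simps)

lemma dfm_morphism_id:
  assumes "dagger_frobenius_monad K X"
  shows "dfm_morphism K X X (dfm_id K X)"
  using assms unfolding dfm_id_def dfm_morphism_iff
  by (auto simp: horiz_id2 lwh_comp1 rwh_comp1)

text \<open>Each law of the composite combines the law of \<open>\<tau>\<close> whiskered by
  \<open>F\<close> with the law of \<open>\<sigma>\<close> whiskered by \<open>G\<close>. The unit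
  law needs nothing more; in the other two, \<open>\<tau>\<close> has to be moved past
  \<open>\<sigma>\<close> or its dagger in between.\<close>

lemma dfm_morphism_comp:
  assumes X: "dagger_frobenius_monad K X" and Y: "dagger_frobenius_monad K Y"
    and Z: "dagger_frobenius_monad K Z"
    and m: "dfm_morphism K X Y (F, \<sigma>)" and n: "dfm_morphism K Y Z (G, \<tau>)"
  shows "dfm_morphism K X Z (dfm_comp K X Y Z (G, \<tau>) (F, \<sigma>))"
proof -
  let ?A = "Base X" and ?B = "Base Y" and ?C = "Base Z"
  let ?S = "Endo X" and ?T = "Endo Y" and ?U = "Endo Z"
  let ?v = "vert K ?A ?C"
  let ?GF = "comp1 K ?A ?B ?C G F"
  note [simp] = X Y Z comp1_comp1
  have [simp]: "F \<in> Ob (Hom K ?A ?B)" "\<sigma> \<in> Ar (Hom K ?A ?B)"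
    "Dom (Hom K ?A ?B) \<sigma> = comp1 K ?A ?B ?B ?T F" "Cod (Hom K ?A ?B) \<sigma> = comp1 K ?A ?A ?B F ?S"
    and m1: "vert K ?A ?B \<sigma> (rwh K ?A ?B ?B (Unt Y) F) = lwh K ?A ?A ?B F (Unt X)"
    and m2: "vert K ?A ?B \<sigma> (rwh K ?A ?B ?B (Mult Y) F)
      = vert K ?A ?B (lwh K ?A ?A ?B F (Mult X))
          (vert K ?A ?B (rwh K ?A ?A ?B \<sigma> ?S) (lwh K ?A ?B ?B ?T \<sigma>))"
    and m3: "vert K ?A ?B (dag2 K ?A ?B \<sigma>)
        (vert K ?A ?B (lwh K ?A ?A ?B F (Mult X)) (rwh K ?A ?A ?B \<sigma> ?S))
      = vert K ?A ?B (rwh K ?A ?B ?B (Mult Y) F) (lwh K ?A ?B ?B ?T (dag2 K ?A ?B \<sigma>))"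
    using m by (auto simp: dfm_morphism_iff)
  have [simp]: "G \<in> Ob (Hom K ?B ?C)" "\<tau> \<in> Ar (Hom K ?B ?C)"
    "Dom (Hom K ?B ?C) \<tau> = comp1 K ?B ?C ?C ?U G" "Cod (Hom K ?B ?C) \<tau> = comp1 K ?B ?B ?C G ?T"
    and n1: "vert K ?B ?C \<tau> (rwh K ?B ?C ?C (Unt Z) G) = lwh K ?B ?B ?C G (Unt Y)"
    and n2: "vert K ?B ?C \<tau> (rwh K ?B ?C ?C (Mult Z) G)
      = vert K ?B ?C (lwh K ?B ?B ?C G (Mult Y))
          (vert K ?B ?C (rwh K ?B ?B ?C \<tau> ?T) (lwh K ?B ?C ?C ?U \<tau>))"
    and n3: "vert K ?B ?C (dag2 K ?B ?C \<tau>)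
        (vert K ?B ?C (lwh K ?B ?B ?C G (Mult Y)) (rwh K ?B ?B ?C \<tau> ?T))
      = vert K ?B ?C (rwh K ?B ?C ?C (Mult Z) G) (lwh K ?B ?C ?C ?U (dag2 K ?B ?C \<tau>))"
    using n by (auto simp: dfm_morphism_iff)
  let ?\<rho> = "?v (lwh K ?A ?B ?C G \<sigma>) (rwh K ?A ?B ?C \<tau> F)"
  note push = lwh_vert rwh_vert lwh_comp1 rwh_comp1 rwh_lwh
  \<comment> \<open>Naturality of \<open>\<tau>\<close> in a 2-cell \<open>\<psi>\<close>; it is
    used at \<open>\<psi> = \<sigma>\<close> for the multiplication law and at the dagger of
    \<open>\<sigma>\<close> for the Frobenius law.\<close>
  have exch: "?v (lwh K ?A ?B ?C (comp1 K ?B ?B ?C G ?T) \<psi>) (rwh K ?A ?B ?C \<tau> (Dom (Hom K ?A ?B) \<psi>))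
      = ?v (rwh K ?A ?B ?C \<tau> (Cod (Hom K ?A ?B) \<psi>)) (lwh K ?A ?B ?C (comp1 K ?B ?C ?C ?U G) \<psi>)"
    if "\<psi> \<in> Ar (Hom K ?A ?B)" for \<psi>
    using that by (simp add: vert_lwh_rwh vert_rwh_lwh)
  have law1: "?v ?\<rho> (rwh K ?A ?C ?C (Unt Z) ?GF) = lwh K ?A ?A ?C ?GF (Unt X)"
  proof -
    have "?v ?\<rho> (rwh K ?A ?C ?C (Unt Z) ?GF)
        = ?v (lwh K ?A ?B ?C G \<sigma>) (rwh K ?A ?B ?C (vert K ?B ?C \<tau> (rwh K ?B ?C ?C (Unt Z) G)) F)"
      by (simp add: push)
    also have "\<dots> = lwh K ?A ?B ?C G (vert K ?A ?B \<sigma> (rwh K ?A ?B ?B (Unt Y) F))"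
      unfolding n1 by (simp add: push)
    also have "\<dots> = lwh K ?A ?A ?C ?GF (Unt X)"
      unfolding m1 by (simp add: push)
    finally show ?thesis .
  qed
  have law2: "?v ?\<rho> (rwh K ?A ?C ?C (Mult Z) ?GF)
      = ?v (lwh K ?A ?A ?C ?GF (Mult X)) (?v (rwh K ?A ?A ?C ?\<rho> ?S) (lwh K ?A ?C ?C ?U ?\<rho>))"
  proof -
    have "?v ?\<rho> (rwh K ?A ?C ?C (Mult Z) ?GF)
        = ?v (lwh K ?A ?B ?C G \<sigma>) (rwh K ?A ?B ?C (vert K ?B ?C \<tau> (rwh K ?B ?C ?C (Mult Z) G)) F)"
      by (simp add: push)
    also have "\<dots> = ?v (lwh K ?A ?B ?C G (vert K ?A ?B \<sigma> (rwh K ?A ?B ?B (Mult Y) F)))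
        (?v (rwh K ?A ?B ?C (rwh K ?B ?B ?C \<tau> ?T) F) (lwh K ?A ?C ?C ?U (rwh K ?A ?B ?C \<tau> F)))"
      unfolding n2 by (simp add: push)
    also have "\<dots> = ?v (lwh K ?A ?A ?C ?GF (Mult X)) (?v (lwh K ?A ?B ?C G (rwh K ?A ?A ?B \<sigma> ?S))
        (?v (?v (lwh K ?A ?B ?C (comp1 K ?B ?B ?C G ?T) \<sigma>) (rwh K ?A ?B ?C \<tau> (comp1 K ?A ?B ?B ?T F)))
          (lwh K ?A ?C ?C ?U (rwh K ?A ?B ?C \<tau> F))))"
      unfolding m2 by (simp add: push)
    \<comment> \<open>Exchange turns the block \<open>GT\<sigma> \<circ> \<tau>TF\<close> into
      \<open>\<tau>FS \<circ> UG\<sigma>\<close>. Then the two outer factors form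
      \<open>?\<rho>\<close> whiskered by \<open>?S\<close> and the two inner ones \<open>?U\<close>
      applied to \<open>?\<rho>\<close>.\<close>
    also have "\<dots> = ?v (lwh K ?A ?A ?C ?GF (Mult X))
        (?v (rwh K ?A ?A ?C ?\<rho> ?S) (lwh K ?A ?C ?C ?U ?\<rho>))"
      using exch[of \<sigma>] by (simp add: push)
    finally show ?thesis .
  qed
  have law3: "?v (dag2 K ?A ?C ?\<rho>) (?v (lwh K ?A ?A ?C ?GF (Mult X)) (rwh K ?A ?A ?C ?\<rho> ?S))
      = ?v (rwh K ?A ?C ?C (Mult Z) ?GF) (lwh K ?A ?C ?C ?U (dag2 K ?A ?C ?\<rho>))"
    (is "?lhs = ?rhs")
  proof -
    let ?\<sigma>' = "dag2 K ?A ?B \<sigma>" and ?\<tau>' = "dag2 K ?B ?C \<tau>"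
    have "?lhs = ?v (rwh K ?A ?B ?C ?\<tau>' F)
        (?v (lwh K ?A ?B ?C G (vert K ?A ?B ?\<sigma>'
          (vert K ?A ?B (lwh K ?A ?A ?B F (Mult X)) (rwh K ?A ?A ?B \<sigma> ?S))))
          (rwh K ?A ?B ?C \<tau> (comp1 K ?A ?A ?B F ?S)))"
      by (simp add: push)
    also have "\<dots> = ?v (rwh K ?A ?B ?C ?\<tau>' F)
        (?v (lwh K ?A ?B ?C G (rwh K ?A ?B ?B (Mult Y) F))
          (?v (lwh K ?A ?B ?C (comp1 K ?B ?B ?C G ?T) ?\<sigma>')
            (rwh K ?A ?B ?C \<tau> (comp1 K ?A ?A ?B F ?S))))"
      unfolding m3 by (simp add: push)
    \<comment> \<open>Moving the dagger of \<open>\<sigma>\<close> to the far right brings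
      \<open>\<tau>T\<close> next to \<open>G\<mu>\<close>, so that the left side of the Frobenius
      law of \<open>\<tau>\<close> appears, whiskered by \<open>F\<close>.\<close>
    also have "\<dots> = ?v (rwh K ?A ?B ?C (vert K ?B ?C ?\<tau>'
          (vert K ?B ?C (lwh K ?B ?B ?C G (Mult Y)) (rwh K ?B ?B ?C \<tau> ?T))) F)
        (lwh K ?A ?B ?C (comp1 K ?B ?C ?C ?U G) ?\<sigma>')"
      using exch[of ?\<sigma>'] by (simp add: push)
    also have "\<dots> = ?rhs"
      unfolding n3 by (simp add: push)
    finally show ?thesis .
  qed
  show ?thesis
    using law1 law2 law3 by (simp add: dfm_comp_def Let_def dfm_morphism_iff)
qed

lemma dfm_morphism_cells [simp]:
  assumes "dfm_morphism K X Y m"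
  shows "fst m \<in> Ob (Hom K (Base X) (Base Y))"
    and "snd m \<in> Ar (Hom K (Base X) (Base Y))"
    and "Dom (Hom K (Base X) (Base Y)) (snd m) = comp1 K (Base X) (Base Y) (Base Y) (Endo Y) (fst m)"
    and "Cod (Hom K (Base X) (Base Y)) (snd m) = comp1 K (Base X) (Base X) (Base Y) (fst m) (Endo X)"
  using assms by (cases m; auto simp: dfm_morphism_iff)+

lemma dfm_square_id:
  assumes "dagger_frobenius_monad K X" "dagger_frobenius_monad K Y" "dfm_morphism K X Y m"
  shows "dfm_square K X Y (snd m) (snd m) (id2 K (Base X) (Base Y) (fst m))"
  using assms by (simp add: dfm_square_def horiz_id2)

lemma dfm_square_vert:
  assumes X: "dagger_frobenius_monad K X" and Y: "dagger_frobenius_monad K Y"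
    and m: "dfm_morphism K X Y m" "dfm_morphism K X Y n" "dfm_morphism K X Y p"
    and \<phi>: "\<phi> \<in> Ar (Hom K (Base X) (Base Y))" "Dom (Hom K (Base X) (Base Y)) \<phi> = fst m"
      "Cod (Hom K (Base X) (Base Y)) \<phi> = fst n"
    and \<psi>: "\<psi> \<in> Ar (Hom K (Base X) (Base Y))" "Dom (Hom K (Base X) (Base Y)) \<psi> = fst n"
      "Cod (Hom K (Base X) (Base Y)) \<psi> = fst p"
    and sq: "dfm_square K X Y (snd m) (snd n) \<phi>" "dfm_square K X Y (snd n) (snd p) \<psi>"
  shows "dfm_square K X Y (snd m) (snd p) (vert K (Base X) (Base Y) \<psi> \<phi>)"
proof -
  let ?A = "Base X" and ?B = "Base Y"
  let ?v = "vert K ?A ?B"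
  let ?T = "lwh K ?A ?B ?B (Endo Y)" and ?S = "\<lambda>\<theta>. rwh K ?A ?A ?B \<theta> (Endo X)"
  note [simp] = X Y m \<phi> \<psi> lwh_vert rwh_vert
  have "?v (snd p) (?T (?v \<psi> \<phi>)) = ?v (?v (snd p) (?T \<psi>)) (?T \<phi>)"
    by simp
  also have "\<dots> = ?v (?S \<psi>) (?v (snd n) (?T \<phi>))"
    using sq(2) by (simp add: dfm_square_def)
  also have "\<dots> = ?v (?S (?v \<psi> \<phi>)) (snd m)"
    using sq(1) by (simp add: dfm_square_def)
  finally show ?thesis
    by (simp add: dfm_square_def)
qed

lemma dfm_comp_components [simp]:
  "fst (dfm_comp K X Y Z n m) = comp1 K (Base X) (Base Y) (Base Z) (fst n) (fst m)"
  "snd (dfm_comp K X Y Z n m) = vert K (Base X) (Base Z)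
    (lwh K (Base X) (Base Y) (Base Z) (fst n) (snd m))
    (rwh K (Base X) (Base Y) (Base Z) (snd n) (fst m))"
  by (auto simp: dfm_comp_def Let_def split: prod.splits)

text \<open>With \<open>\<psi>\<phi>\<close> split as \<open>\<psi>\<close> whiskered first and
  \<open>\<phi>\<close> second, the structure cell of \<open>n'\<close> is moved past
  \<open>\<phi>\<close>; the two given squares then apply independently, and a second exchange moves
  \<open>\<psi>\<close> past the structure cell of \<open>m\<close>.\<close>

lemma dfm_square_horiz:
  assumes X: "dagger_frobenius_monad K X" and Y: "dagger_frobenius_monad K Y"
    and Z: "dagger_frobenius_monad K Z"
    and m: "dfm_morphism K X Y m" "dfm_morphism K X Y m'"
    and n: "dfm_morphism K Y Z n" "dfm_morphism K Y Z n'"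
    and \<phi>: "\<phi> \<in> Ar (Hom K (Base X) (Base Y))" "Dom (Hom K (Base X) (Base Y)) \<phi> = fst m"
      "Cod (Hom K (Base X) (Base Y)) \<phi> = fst m'"
    and \<psi>: "\<psi> \<in> Ar (Hom K (Base Y) (Base Z))" "Dom (Hom K (Base Y) (Base Z)) \<psi> = fst n"
      "Cod (Hom K (Base Y) (Base Z)) \<psi> = fst n'"
    and sq: "dfm_square K X Y (snd m) (snd m') \<phi>" "dfm_square K Y Z (snd n) (snd n') \<psi>"
  shows "dfm_square K X Z (snd (dfm_comp K X Y Z n m)) (snd (dfm_comp K X Y Z n' m'))
    (horiz K (Base X) (Base Y) (Base Z) \<psi> \<phi>)"
proof -
  let ?A = "Base X" and ?B = "Base Y" and ?C = "Base Z"
  let ?S = "Endo X" and ?T = "Endo Y" and ?U = "Endo Z"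
  let ?v = "vert K ?A ?C"
  note [simp] = X Y Z m n \<phi> \<psi> comp1_comp1
  note push = lwh_vert rwh_vert lwh_comp1 rwh_comp1 rwh_lwh
  let ?lw = "lwh K ?A ?B ?C" and ?rw = "rwh K ?A ?B ?C"
  let ?h = "horiz K ?A ?B ?C \<psi> \<phi>"
  let ?\<phi>S = "rwh K ?A ?A ?B \<phi> ?S" and ?T\<phi> = "lwh K ?A ?B ?B ?T \<phi>"
  let ?\<psi>T = "rwh K ?B ?B ?C \<psi> ?T" and ?U\<psi> = "lwh K ?B ?C ?C ?U \<psi>"
  have h_eq: "?h = ?v (?lw (fst n') \<phi>) (?rw \<psi> (fst m))"
    by (simp add: vert_lwh_rwh)
  have exch: "?v (?rw \<theta> (Cod (Hom K ?A ?B) \<kappa>)) (?lw (Dom (Hom K ?B ?C) \<theta>) \<kappa>)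
      = ?v (?lw (Cod (Hom K ?B ?C) \<theta>) \<kappa>) (?rw \<theta> (Dom (Hom K ?A ?B) \<kappa>))"
    if "\<kappa> \<in> Ar (Hom K ?A ?B)" "\<theta> \<in> Ar (Hom K ?B ?C)" for \<kappa> \<theta>
    using that by (simp add: vert_lwh_rwh vert_rwh_lwh)
  have "?v (snd (dfm_comp K X Y Z n' m')) (lwh K ?A ?C ?C ?U ?h)
      = ?v (?lw (fst n') (snd m')) (?v (?v (?rw (snd n') (fst m'))
          (?lw (comp1 K ?B ?C ?C ?U (fst n')) \<phi>)) (?rw ?U\<psi> (fst m)))"
    unfolding h_eq by (simp add: push)
  also have "\<dots> = ?v (?lw (fst n') (vert K ?A ?B (snd m') ?T\<phi>))
      (?rw (vert K ?B ?C (snd n') ?U\<psi>) (fst m))"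
    using exch[of \<phi> "snd n'"] by (simp add: push)
  also have "\<dots> = ?v (?lw (fst n') (vert K ?A ?B ?\<phi>S (snd m)))
      (?rw (vert K ?B ?C ?\<psi>T (snd n)) (fst m))"
    using sq by (simp add: dfm_square_def)
  also have "\<dots> = ?v (?lw (fst n') ?\<phi>S) (?v (?v (?lw (fst n') (snd m))
      (?rw \<psi> (comp1 K ?A ?B ?B ?T (fst m)))) (?rw (snd n) (fst m)))"
    by (simp add: push)
  also have "\<dots> = ?v (rwh K ?A ?A ?C ?h ?S) (snd (dfm_comp K X Y Z n m))"
    using exch[of "snd m" \<psi>, symmetric] unfolding h_eq by (simp add: push)
  finally show ?thesis
    by (simp add: dfm_square_def)
qed

section \<open>The axioms of a dagger 2-category for \<open>DFMonad K\<close>, and the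
  inclusion\<close>

lemma dagger_category_DFMonad_hom:
  assumes X: "dagger_frobenius_monad K X" and Y: "dagger_frobenius_monad K Y"
  shows "dagger_category (DFMonad_hom K X Y)"
proof unfold_locales
  note [simp] = X Y
  note [simp] = DFMonad_hom_def arrows_def dfm_transformation_iff
  note sq = dfm_square_id[OF X Y] dfm_square_vert[OF X Y]
  show "Dom (DFMonad_hom K X Y) f \<in> Ob (DFMonad_hom K X Y)" if "f \<in> Ar (DFMonad_hom K X Y)" for f
    using that by auto
  show "Cod (DFMonad_hom K X Y) f \<in> Ob (DFMonad_hom K X Y)" if "f \<in> Ar (DFMonad_hom K X Y)" for f
    using that by auto
  show "Ident (DFMonad_hom K X Y) m \<in> arrows (DFMonad_hom K X Y) m m"
    if "m \<in> Ob (DFMonad_hom K X Y)" for m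
    using that by (auto intro: sq)
  show "Cmp (DFMonad_hom K X Y) g f \<in> arrows (DFMonad_hom K X Y) m p"
    if f: "f \<in> arrows (DFMonad_hom K X Y) m n" and g: "g \<in> arrows (DFMonad_hom K X Y) n p"
    for f g m n p
  proof -
    obtain \<phi> where \<phi>: "f = (m, n, \<phi>)" using f by (cases f) simp
    obtain \<psi> where \<psi>: "g = (n, p, \<psi>)" using g by (cases g) simp
    \<comment> \<open>The second instance, with the daggers in reverse order, supplies the square
      for the dagger of the composite.\<close>
    show ?thesis
      using f g sq(2)[of m n p \<phi> \<psi>]
        sq(2)[of p n m "dag2 K (Base X) (Base Y) \<psi>" "dag2 K (Base X) (Base Y) \<phi>"]
      unfolding \<phi> \<psi> by simp
  qed
  show "Dag (DFMonad_hom K X Y) f \<in> arrows (DFMonad_hom K X Y) n m"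
    if "f \<in> arrows (DFMonad_hom K X Y) m n" for f m n
    using that by auto
qed (use X Y in \<open>auto simp: DFMonad_hom_def arrows_def dfm_transformation_iff\<close>)

lemma dfm_morphism_dfm_comp:
  assumes "dagger_frobenius_monad K X" "dagger_frobenius_monad K Y" "dagger_frobenius_monad K Z"
    and "dfm_morphism K X Y m" "dfm_morphism K Y Z n"
  shows "dfm_morphism K X Z (dfm_comp K X Y Z n m)"
  using dfm_morphism_comp[OF assms(1-3), of "fst m" "snd m" "fst n" "snd n"] assms(4,5) by simp

lemma dagger_functor_DFMonad_HComp:
  assumes X: "dagger_frobenius_monad K X" and Y: "dagger_frobenius_monad K Y"
    and Z: "dagger_frobenius_monad K Z"
  shows "dagger_functor (prod_dagcat (DFMonad_hom K Y Z) (DFMonad_hom K X Y)) (DFMonad_hom K X Z)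
    (HComp (DFMonad K) X Y Z)"
proof (intro dagger_functor.intro dagger_functor_axioms.intro dagger_category_prod
    dagger_category_DFMonad_hom X Y Z)
\<comment> \<open>The 2-cell of a composite morphism is kept folded, because
  \<open>dfm_square_horiz\<close> is stated for \<open>snd (dfm_comp ...)\<close>.\<close>
qed (use X Y Z in \<open>auto simp: DFMonad_def DFMonad_hom_def prod_dagcat_def arrows_def
    dfm_transformation_iff horiz_id2 horiz_vert
    dfm_morphism_iff[THEN iffD1, THEN conjunct1]
    intro!: dfm_morphism_dfm_comp dfm_square_horiz simp del: dfm_comp_components(2)\<close>)

lemma dagger_functor_DFMonad_HUnit:
  assumes X: "dagger_frobenius_monad K X"
  shows "dagger_functor terminal_dagcat (DFMonad_hom K X X) (HUnit (DFMonad K) X)"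
proof (intro dagger_functor.intro dagger_functor_axioms.intro dagger_category_DFMonad_hom X)
  show "dagger_category terminal_dagcat"
    by unfold_locales (auto simp: terminal_dagcat_def arrows_def)
qed (use X dfm_morphism_id[OF X] dfm_square_id[OF X X dfm_morphism_id[OF X]]
    in \<open>auto simp: DFMonad_def DFMonad_hom_def terminal_dagcat_def arrows_def
      dfm_transformation_iff dfm_id_def\<close>)

lemma dfm_comp_assoc:
  assumes X: "dagger_frobenius_monad K W" "dagger_frobenius_monad K X"
      "dagger_frobenius_monad K Y" "dagger_frobenius_monad K Z"
    and m: "dfm_morphism K W X m" "dfm_morphism K X Y n" "dfm_morphism K Y Z p"
  shows "dfm_comp K W Y Z p (dfm_comp K W X Y n m) = dfm_comp K W X Z (dfm_comp K X Y Z p n) m"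
  using assms by (intro prod_eqI)
    (auto simp: comp1_comp1 lwh_vert rwh_vert lwh_comp1 rwh_comp1 rwh_lwh)

lemma dfm_comp_id_left:
  assumes X: "dagger_frobenius_monad K X" "dagger_frobenius_monad K Y"
    and m: "dfm_morphism K X Y m"
  shows "dfm_comp K X Y Y (dfm_id K Y) m = m"
  using assms by (intro prod_eqI) (auto simp: dfm_id_def horiz_id2)

lemma dfm_comp_id_right:
  assumes X: "dagger_frobenius_monad K X" "dagger_frobenius_monad K Y"
    and m: "dfm_morphism K X Y m"
  shows "dfm_comp K X X Y m (dfm_id K X) = m"
  using assms by (intro prod_eqI) (auto simp: dfm_id_def horiz_id2)

lemma dagger_2_category_DFMonad: "dagger_2_category (DFMonad K)"
proof (rule dagger_2_category.intro)
  show "dagger_category (Hom (DFMonad K) X Y)" if "X \<in> Ob0 (DFMonad K)" "Y \<in> Ob0 (DFMonad K)" for X Y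
    using that dagger_category_DFMonad_hom by (simp add: DFMonad_def)
  show "dagger_functor (prod_dagcat (Hom (DFMonad K) Y Z) (Hom (DFMonad K) X Y)) (Hom (DFMonad K) X Z)
    (HComp (DFMonad K) X Y Z)"
    if "X \<in> Ob0 (DFMonad K)" "Y \<in> Ob0 (DFMonad K)" "Z \<in> Ob0 (DFMonad K)" for X Y Z
    using that dagger_functor_DFMonad_HComp by (simp add: DFMonad_def)
  show "dagger_functor terminal_dagcat (Hom (DFMonad K) X X) (HUnit (DFMonad K) X)"
    if "X \<in> Ob0 (DFMonad K)" for X
    using that dagger_functor_DFMonad_HUnit by (simp add: DFMonad_def)
qed (auto simp: DFMonad_def DFMonad_hom_def dfm_comp_assoc dfm_comp_id_left dfm_comp_id_right
  dfm_transformation_iff horiz_assoc)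

lemma dagger_frobenius_monad_inclusion:
  assumes "A \<in> Ob0 K"
  shows "dagger_frobenius_monad K (On0 (DFMonad_inclusion K) A)"
  using assms by (auto simp: DFMonad_inclusion_def dagger_frobenius_monad_def Let_def arrows_def)

lemma dagger_2_functor_inclusion: "dagger_2_functor K (DFMonad K) (DFMonad_inclusion K)"
proof (intro dagger_2_functor.intro dagger_2_functor_axioms.intro dagger_2_category_DFMonad)
  show "dagger_2_category K" ..
  show "On0 (DFMonad_inclusion K) A \<in> Ob0 (DFMonad K)" if "A \<in> Ob0 K" for A
    using dagger_frobenius_monad_inclusion[OF that] by (simp add: DFMonad_def)
  show "dagger_functor (Hom K A B) (Hom (DFMonad K) (On0 (DFMonad_inclusion K) A)
      (On0 (DFMonad_inclusion K) B)) (OnHom (DFMonad_inclusion K) A B)"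
    if [simp]: "A \<in> Ob0 K" "B \<in> Ob0 K" for A B
  proof (intro dagger_functor.intro dagger_functor_axioms.intro)
    show "dagger_category (Hom K A B)" by (simp add: Hom)
    show "dagger_category (Hom (DFMonad K) (On0 (DFMonad_inclusion K) A) (On0 (DFMonad_inclusion K) B))"
      using dagger_category_DFMonad_hom[OF that[THEN dagger_frobenius_monad_inclusion]]
      by (simp add: DFMonad_def)
  qed (auto simp: DFMonad_def DFMonad_hom_def DFMonad_inclusion_def Let_def arrows_def
      dfm_transformation_iff dfm_morphism_iff dfm_square_def horiz_id2)
qed (auto simp: DFMonad_inclusion_def DFMonad_def dfm_comp_def dfm_id_def Let_def horiz_id2 HUnit_id2)

end

section \<open>Right adjoints from universal arrows\<close>

context dagger_2_functor
begin

lemmas OnHom_simps [simp] = dagger_functor.functor_simps[OF OnHom]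
lemmas On0_closed [simp] = On0_Ob0

end

lemma id_2fun_simps [simp]:
  "On0 id_2fun A = A" "on1 id_2fun A B F = F" "on2 id_2fun A B \<phi> = \<phi>"
  by (simp_all add: id_2fun_def)

lemma comp_2fun_simps [simp]:
  "On0 (comp_2fun Q P) A = On0 Q (On0 P A)"
  "on1 (comp_2fun Q P) A B F = on1 Q (On0 P A) (On0 P B) (on1 P A B F)"
  "on2 (comp_2fun Q P) A B \<phi> = on2 Q (On0 P A) (On0 P B) (on2 P A B \<phi>)"
  by (simp_all add: comp_2fun_def)

lemma dagger_2_functor_id:
  assumes "dagger_2_category K"
  shows "dagger_2_functor K K id_2fun"
proof -
  interpret dagger_2_category K by fact
  show ?thesis
    by (intro dagger_2_functor.intro dagger_2_functor_axioms.intro dagger_functor.intro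
        dagger_functor_axioms.intro assms) (auto simp: Hom)
qed

lemma dagger_2_functor_comp:
  assumes "dagger_2_functor K L P" "dagger_2_functor L M Q"
  shows "dagger_2_functor K M (comp_2fun Q P)"
proof -
  interpret P: dagger_2_functor K L P by fact
  interpret Q: dagger_2_functor L M Q by fact
  show ?thesis
  proof (intro dagger_2_functor.intro dagger_2_functor_axioms.intro dagger_functor.intro
      dagger_functor_axioms.intro P.K.dagger_2_category_axioms Q.L.dagger_2_category_axioms)
  qed (auto simp: P.K.Hom Q.L.Hom arrows_def P.on1_comp1 Q.on1_comp1 P.on2_horiz Q.on2_horiz
      P.on1_id1 Q.on1_id1 P.on2_unit Q.on2_unit)
qed

text \<open>Composition with \<open>\<epsilon> X\<close> after applying \<open>L\<close> is an
  isomorphism of hom-categories, given as two bijections. \<open>R\<close> is prescribed on 0-cells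
  only; its action on hom-categories is derived from the bijections.\<close>

locale universal_arrows = F: dagger_2_functor K M L
  for K :: "('o, 'f, 't) dag2cat" and M :: "('p, 'g, 's) dag2cat"
    and L :: "('o, 'f, 't, 'p, 'g, 's) dag2fun" +
  fixes R :: "'p \<Rightarrow> 'o" and \<epsilon> :: "'p \<Rightarrow> 'g"
  assumes R_Ob0 [simp]: "X \<in> Ob0 M \<Longrightarrow> R X \<in> Ob0 K"
    and \<epsilon>_Ob [simp]: "X \<in> Ob0 M \<Longrightarrow> \<epsilon> X \<in> Ob (Hom M (On0 L (R X)) X)"
    and bij_Ob: "\<lbrakk>A \<in> Ob0 K; X \<in> Ob0 M\<rbrakk>
      \<Longrightarrow> bij_betw (\<lambda>F. comp1 M (On0 L A) (On0 L (R X)) X (\<epsilon> X) (on1 L A (R X) F))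
            (Ob (Hom K A (R X))) (Ob (Hom M (On0 L A) X))"
    and bij_Ar: "\<lbrakk>A \<in> Ob0 K; X \<in> Ob0 M\<rbrakk>
      \<Longrightarrow> bij_betw (\<lambda>\<phi>. lwh M (On0 L A) (On0 L (R X)) X (\<epsilon> X) (on2 L A (R X) \<phi>))
            (Ar (Hom K A (R X))) (Ar (Hom M (On0 L A) X))"
begin

definition "post1 A X F = comp1 M (On0 L A) (On0 L (R X)) X (\<epsilon> X) (on1 L A (R X) F)"

definition "post2 A X \<phi> = lwh M (On0 L A) (On0 L (R X)) X (\<epsilon> X) (on2 L A (R X) \<phi>)"

definition "factor1 A X = inv_into (Ob (Hom K A (R X))) (post1 A X)"

definition "factor2 A X = inv_into (Ar (Hom K A (R X))) (post2 A X)"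

text \<open>The image of \<open>m\<close> is the unique 1-cell \<open>F\<close> with
  \<open>\<epsilon> Y \<circ> L F = m \<circ> \<epsilon> X\<close>, and similarly for 2-cells:
  naturality of the counit is taken as the defining equation.\<close>

definition "adjoint = \<lparr>On0 = R, OnHom = (\<lambda>X Y.
  \<lparr>FOb = (\<lambda>m. factor1 (R X) Y (comp1 M (On0 L (R X)) X Y m (\<epsilon> X))),
   FAr = (\<lambda>\<phi>. factor2 (R X) Y (rwh M (On0 L (R X)) X Y \<phi> (\<epsilon> X)))\<rparr>)\<rparr>"

text \<open>The defining equation of this factorization is the first triangle identity.\<close>

definition "adjunit A = factor1 A (On0 L A) (id1 M (On0 L A))"

context
  fixes A X
  assumes A [simp]: "A \<in> Ob0 K" and X [simp]: "X \<in> Ob0 M"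
begin

lemma bij_post1: "bij_betw (post1 A X) (Ob (Hom K A (R X))) (Ob (Hom M (On0 L A) X))"
  using bij_Ob[OF A X] by (simp add: post1_def[abs_def])

lemma bij_post2: "bij_betw (post2 A X) (Ar (Hom K A (R X))) (Ar (Hom M (On0 L A) X))"
  using bij_Ar[OF A X] by (simp add: post2_def[abs_def])

lemma post2_simps:
  assumes "\<phi> \<in> Ar (Hom K A (R X))"
  shows "post2 A X \<phi> \<in> Ar (Hom M (On0 L A) X)"
    and "Dom (Hom M (On0 L A) X) (post2 A X \<phi>) = post1 A X (Dom (Hom K A (R X)) \<phi>)"
    and "Cod (Hom M (On0 L A) X) (post2 A X \<phi>) = post1 A X (Cod (Hom K A (R X)) \<phi>)"
    and "dag2 M (On0 L A) X (post2 A X \<phi>) = post2 A X (dag2 K A (R X) \<phi>)"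
  using assms by (simp_all add: post1_def post2_def)

lemma post2_id2:
  "F \<in> Ob (Hom K A (R X)) \<Longrightarrow> post2 A X (id2 K A (R X) F) = id2 M (On0 L A) X (post1 A X F)"
  by (simp add: post1_def post2_def F.L.horiz_id2)

lemma post2_vert:
  assumes "\<phi> \<in> Ar (Hom K A (R X))" "\<psi> \<in> Ar (Hom K A (R X))"
    and "Dom (Hom K A (R X)) \<psi> = Cod (Hom K A (R X)) \<phi>"
  shows "post2 A X (vert K A (R X) \<psi> \<phi>) = vert M (On0 L A) X (post2 A X \<psi>) (post2 A X \<phi>)"
  using assms by (simp add: post2_def F.L.lwh_vert)

lemma factor1 [simp]:
  assumes "m \<in> Ob (Hom M (On0 L A) X)"
  shows factor1_Ob: "factor1 A X m \<in> Ob (Hom K A (R X))"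
    and post1_factor1: "post1 A X (factor1 A X m) = m"
  using assms bij_post1
  by (auto simp: factor1_def bij_betw_def inv_into_into f_inv_into_f)

lemma factor2 [simp]:
  assumes "\<theta> \<in> Ar (Hom M (On0 L A) X)"
  shows factor2_Ar: "factor2 A X \<theta> \<in> Ar (Hom K A (R X))"
    and post2_factor2: "post2 A X (factor2 A X \<theta>) = \<theta>"
  using assms bij_post2
  by (auto simp: factor2_def bij_betw_def inv_into_into f_inv_into_f)

lemma post1_inject:
  "\<lbrakk>F \<in> Ob (Hom K A (R X)); G \<in> Ob (Hom K A (R X)); post1 A X F = post1 A X G\<rbrakk> \<Longrightarrow> F = G"
  using bij_post1 by (auto simp: bij_betw_def inj_on_def)

lemma post2_inject:
  "\<lbrakk>\<phi> \<in> Ar (Hom K A (R X)); \<psi> \<in> Ar (Hom K A (R X)); post2 A X \<phi> = post2 A X \<psi>\<rbrakk> \<Longrightarrow> \<phi> = \<psi>"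
  using bij_post2 by (auto simp: bij_betw_def inj_on_def)

text \<open>\<open>post2\<close> commutes with source, target and dagger, and is injective along
  with \<open>post1\<close>; hence its inverse commutes with them too.\<close>

lemma factor2_simps [simp]:
  assumes "\<theta> \<in> Ar (Hom M (On0 L A) X)"
  shows "Dom (Hom K A (R X)) (factor2 A X \<theta>) = factor1 A X (Dom (Hom M (On0 L A) X) \<theta>)"
    and "Cod (Hom K A (R X)) (factor2 A X \<theta>) = factor1 A X (Cod (Hom M (On0 L A) X) \<theta>)"
    and "dag2 K A (R X) (factor2 A X \<theta>) = factor2 A X (dag2 M (On0 L A) X \<theta>)"
  using assms
  by (auto intro!: post1_inject post2_inject simp: post2_simps(2-)[symmetric])

lemma factor2_id2:
  "m \<in> Ob (Hom M (On0 L A) X) \<Longrightarrow> factor2 A X (id2 M (On0 L A) X m) = id2 K A (R X) (factor1 A X m)"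
  by (rule post2_inject) (simp_all add: post2_id2)

lemma factor2_vert:
  assumes "\<phi> \<in> Ar (Hom M (On0 L A) X)" "\<psi> \<in> Ar (Hom M (On0 L A) X)"
    and "Dom (Hom M (On0 L A) X) \<psi> = Cod (Hom M (On0 L A) X) \<phi>"
  shows "factor2 A X (vert M (On0 L A) X \<psi> \<phi>) = vert K A (R X) (factor2 A X \<psi>) (factor2 A X \<phi>)"
  using assms by (intro post2_inject) (simp_all add: post2_vert)

end

lemma post1_comp1:
  assumes "A \<in> Ob0 K" "B \<in> Ob0 K" "X \<in> Ob0 M" "F \<in> Ob (Hom K A B)" "G \<in> Ob (Hom K B (R X))"
  shows "post1 A X (comp1 K A B (R X) G F)
    = comp1 M (On0 L A) (On0 L B) X (post1 B X G) (on1 L A B F)"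
  using assms by (simp add: post1_def F.on1_comp1 F.L.comp1_assoc)

lemma post2_horiz:
  assumes "A \<in> Ob0 K" "B \<in> Ob0 K" "X \<in> Ob0 M" "\<phi> \<in> Ar (Hom K A B)" "\<psi> \<in> Ar (Hom K B (R X))"
  shows "post2 A X (horiz K A B (R X) \<psi> \<phi>)
    = horiz M (On0 L A) (On0 L B) X (post2 B X \<psi>) (on2 L A B \<phi>)"
  using assms by (simp add: post2_def F.on2_horiz F.L.horiz_assoc)

lemma adjunit:
  assumes "A \<in> Ob0 K"
  shows "adjunit A \<in> Ob (Hom K A (R (On0 L A)))"
    and "post1 A (On0 L A) (adjunit A) = id1 M (On0 L A)"
  using assms by (simp_all add: adjunit_def)

section \<open>The right adjoint 2-functor and the adjunction\<close>

lemma adjoint_On0 [simp]: "On0 adjoint X = R X"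
  by (simp add: adjoint_def)

lemma adjoint_on1:
  assumes "X \<in> Ob0 M" "Y \<in> Ob0 M" "m \<in> Ob (Hom M X Y)"
  shows "on1 adjoint X Y m \<in> Ob (Hom K (R X) (R Y))"
    and "post1 (R X) Y (on1 adjoint X Y m) = comp1 M (On0 L (R X)) X Y m (\<epsilon> X)"
  using assms by (simp_all add: adjoint_def)

lemma adjoint_on2:
  assumes "X \<in> Ob0 M" "Y \<in> Ob0 M" "\<phi> \<in> Ar (Hom M X Y)"
  shows "on2 adjoint X Y \<phi> \<in> Ar (Hom K (R X) (R Y))"
    and "post2 (R X) Y (on2 adjoint X Y \<phi>) = rwh M (On0 L (R X)) X Y \<phi> (\<epsilon> X)"
  using assms by (simp_all add: adjoint_def)

lemma dagger_functor_adjoint: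
  assumes "X \<in> Ob0 M" "Y \<in> Ob0 M"
  shows "dagger_functor (Hom M X Y) (Hom K (R X) (R Y)) (OnHom adjoint X Y)"
proof (intro dagger_functor.intro dagger_functor_axioms.intro)
  show "dagger_category (Hom M X Y)" "dagger_category (Hom K (R X) (R Y))"
    using assms by (simp_all add: F.K.Hom F.L.Hom)
qed (use assms in \<open>auto simp: adjoint_def arrows_def factor2_id2 factor2_vert
    F.L.horiz_id2 F.L.rwh_vert\<close>)

text \<open>Both sides of the laws for composites and for the identity 1-cell are compared after
  \<open>post1\<close> or \<open>post2\<close>. For a composite, the defining equation of the
  adjoint is used once for each factor, which moves the counit from the left end to the right
  end.\<close>

lemma dagger_2_functor_adjoint: "dagger_2_functor M K adjoint"
proof (intro dagger_2_functor.intro dagger_2_functor_axioms.intro)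
  show "dagger_2_category K" "dagger_2_category M" ..
  show "On0 adjoint X \<in> Ob0 K" if "X \<in> Ob0 M" for X
    using that by simp
  show "dagger_functor (Hom M X Y) (Hom K (On0 adjoint X) (On0 adjoint Y)) (OnHom adjoint X Y)"
    if "X \<in> Ob0 M" "Y \<in> Ob0 M" for X Y
    using that by (simp add: dagger_functor_adjoint)
  show "on1 adjoint X Z (comp1 M X Y Z n m)
      = comp1 K (On0 adjoint X) (On0 adjoint Y) (On0 adjoint Z) (on1 adjoint Y Z n) (on1 adjoint X Y m)"
    if [simp]: "X \<in> Ob0 M" "Y \<in> Ob0 M" "Z \<in> Ob0 M" "m \<in> Ob (Hom M X Y)" "n \<in> Ob (Hom M Y Z)"
    for X Y Z m n
  proof (rule post1_inject[of "R X" Z])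
    have "post1 (R X) Z (comp1 K (R X) (R Y) (R Z) (on1 adjoint Y Z n) (on1 adjoint X Y m))
        = comp1 M (On0 L (R X)) (On0 L (R Y)) Z (comp1 M (On0 L (R Y)) Y Z n (\<epsilon> Y))
            (on1 L (R X) (R Y) (on1 adjoint X Y m))"
      by (simp add: adjoint_on1 post1_comp1)
    also have "\<dots> = comp1 M (On0 L (R X)) Y Z n (post1 (R X) Y (on1 adjoint X Y m))"
      by (simp add: adjoint_on1(1) post1_def F.L.comp1_comp1)
    finally show "post1 (R X) Z (on1 adjoint X Z (comp1 M X Y Z n m)) = post1 (R X) Z
        (comp1 K (On0 adjoint X) (On0 adjoint Y) (On0 adjoint Z) (on1 adjoint Y Z n) (on1 adjoint X Y m))"
      by (simp add: adjoint_on1 F.L.comp1_assoc)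
  qed (simp_all add: adjoint_on1)
  show "on2 adjoint X Z (horiz M X Y Z \<psi> \<phi>)
      = horiz K (On0 adjoint X) (On0 adjoint Y) (On0 adjoint Z) (on2 adjoint Y Z \<psi>) (on2 adjoint X Y \<phi>)"
    if [simp]: "X \<in> Ob0 M" "Y \<in> Ob0 M" "Z \<in> Ob0 M" "\<phi> \<in> Ar (Hom M X Y)" "\<psi> \<in> Ar (Hom M Y Z)"
    for X Y Z \<phi> \<psi>
  proof (rule post2_inject[of "R X" Z])
    have "post2 (R X) Z (horiz K (R X) (R Y) (R Z) (on2 adjoint Y Z \<psi>) (on2 adjoint X Y \<phi>))
        = horiz M (On0 L (R X)) (On0 L (R Y)) Z (rwh M (On0 L (R Y)) Y Z \<psi> (\<epsilon> Y))
            (on2 L (R X) (R Y) (on2 adjoint X Y \<phi>))"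
      by (simp add: adjoint_on2 post2_horiz)
    also have "\<dots> = horiz M (On0 L (R X)) Y Z \<psi> (post2 (R X) Y (on2 adjoint X Y \<phi>))"
      by (simp add: adjoint_on2(1) post2_def F.L.horiz_assoc[symmetric])
    finally show "post2 (R X) Z (on2 adjoint X Z (horiz M X Y Z \<psi> \<phi>)) = post2 (R X) Z
        (horiz K (On0 adjoint X) (On0 adjoint Y) (On0 adjoint Z) (on2 adjoint Y Z \<psi>) (on2 adjoint X Y \<phi>))"
      by (simp add: adjoint_on2 F.L.horiz_assoc)
  qed (simp_all add: adjoint_on2)
  show id1: "on1 adjoint X X (id1 M X) = id1 K (On0 adjoint X)" if [simp]: "X \<in> Ob0 M" for X
    by (rule post1_inject[of "R X" X]) (simp_all add: adjoint_on1, simp add: post1_def F.on1_id1)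
  \<comment> \<open>A unit 2-cell is the identity on the unit 1-cell, so this follows from
    \<open>id1\<close> and preservation of identity 2-cells.\<close>
  show "on2 adjoint X X (FAr (HUnit M X) ()) = FAr (HUnit K (On0 adjoint X)) ()"
    if [simp]: "X \<in> Ob0 M" for X
    using id1[of X] dagger_functor.FAr_Ident[OF dagger_functor_adjoint, of X X "id1 M X"]
    by (simp add: F.K.HUnit_id2 F.L.HUnit_id2)
qed

text \<open>After \<open>post1\<close> or \<open>post2\<close> both sides of each naturality
  equation become the image of the given cell under \<open>L\<close>: the counit and the unit cancel
  by the first triangle identity.\<close>

lemma two_natural_adjunit: "two_natural_transformation K K id_2fun (comp_2fun adjoint L) adjunit"
proof (intro two_natural_transformation.intro two_natural_transformation_axioms.intro
    dagger_2_functor_id dagger_2_functor_comp[OF F.dagger_2_functor_axioms dagger_2_functor_adjoint]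
    F.K.dagger_2_category_axioms)
  show "adjunit A \<in> Ob (Hom K (On0 id_2fun A) (On0 (comp_2fun adjoint L) A))"
    if "A \<in> Ob0 K" for A
    using that by (simp add: adjunit)
  show "comp1 K (On0 id_2fun A) (On0 id_2fun B) (On0 (comp_2fun adjoint L) B) (adjunit B)
        (on1 id_2fun A B F)
      = comp1 K (On0 id_2fun A) (On0 (comp_2fun adjoint L) A) (On0 (comp_2fun adjoint L) B)
        (on1 (comp_2fun adjoint L) A B F) (adjunit A)"
    if [simp]: "A \<in> Ob0 K" "B \<in> Ob0 K" "F \<in> Ob (Hom K A B)" for A B F
  proof -
    let ?LA = "On0 L A" and ?LB = "On0 L B" and ?LF = "on1 L A B F"
    have "post1 A ?LB (comp1 K A (R ?LA) (R ?LB) (on1 adjoint ?LA ?LB ?LF) (adjunit A))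
        = comp1 M ?LA (On0 L (R ?LA)) ?LB (comp1 M (On0 L (R ?LA)) ?LA ?LB ?LF (\<epsilon> ?LA))
            (on1 L A (R ?LA) (adjunit A))"
      by (simp add: adjunit post1_comp1 adjoint_on1)
    also have "\<dots> = comp1 M ?LA ?LA ?LB ?LF (post1 A ?LA (adjunit A))"
      by (simp add: adjunit(1) post1_def F.L.comp1_comp1)
    finally show ?thesis
      by (auto intro!: post1_inject[of A ?LB] simp: adjunit post1_comp1 adjoint_on1)
  qed
  show "lwh K (On0 id_2fun A) (On0 id_2fun B) (On0 (comp_2fun adjoint L) B) (adjunit B)
        (on2 id_2fun A B \<phi>)
      = rwh K (On0 id_2fun A) (On0 (comp_2fun adjoint L) A) (On0 (comp_2fun adjoint L) B)
        (on2 (comp_2fun adjoint L) A B \<phi>) (adjunit A)"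
    if [simp]: "A \<in> Ob0 K" "B \<in> Ob0 K" "\<phi> \<in> Ar (Hom K A B)" for A B \<phi>
  proof -
    let ?LA = "On0 L A" and ?LB = "On0 L B" and ?L\<phi> = "on2 L A B \<phi>"
    have "post2 A ?LB (rwh K A (R ?LA) (R ?LB) (on2 adjoint ?LA ?LB ?L\<phi>) (adjunit A))
        = horiz M ?LA (On0 L (R ?LA)) ?LB (rwh M (On0 L (R ?LA)) ?LA ?LB ?L\<phi> (\<epsilon> ?LA))
            (on2 L A (R ?LA) (id2 K A (R ?LA) (adjunit A)))"
      by (simp add: adjunit post2_horiz adjoint_on2)
    also have "\<dots> = rwh M ?LA ?LA ?LB ?L\<phi> (post1 A ?LA (adjunit A))"
      by (simp add: adjunit(1) post1_def F.L.horiz_assoc[symmetric] F.L.horiz_id2)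
    finally show ?thesis
      by (auto intro!: post2_inject[of A ?LB] simp: adjunit post2_horiz post2_id2 adjoint_on2)
  qed
qed

lemma dagger_2_adjunction: "dagger_2_adjunction K M L adjoint adjunit \<epsilon>"
proof (intro dagger_2_adjunction.intro dagger_2_adjunction_axioms.intro two_natural_adjunit
    F.dagger_2_functor_axioms dagger_2_functor_adjoint)
  show "two_natural_transformation M M (comp_2fun L adjoint) id_2fun \<epsilon>"
  proof (intro two_natural_transformation.intro two_natural_transformation_axioms.intro
      dagger_2_functor_id dagger_2_functor_comp[OF dagger_2_functor_adjoint F.dagger_2_functor_axioms]
      F.L.dagger_2_category_axioms)
  \<comment> \<open>Naturality of the counit is the characterization of \<open>adjoint\<close> read
    from the other side.\<close>
  qed (use adjoint_on1 adjoint_on2 in \<open>simp_all add: post1_def post2_def\<close>)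
  show "comp1 M (On0 L A) (On0 L (On0 adjoint (On0 L A))) (On0 L A) (\<epsilon> (On0 L A))
      (on1 L A (On0 adjoint (On0 L A)) (adjunit A)) = id1 M (On0 L A)" if "A \<in> Ob0 K" for A
    using adjunit(2)[OF that] by (simp add: post1_def)
  show "comp1 K (On0 adjoint X) (On0 adjoint (On0 L (On0 adjoint X))) (On0 adjoint X)
      (on1 adjoint (On0 L (On0 adjoint X)) X (\<epsilon> X)) (adjunit (On0 adjoint X))
      = id1 K (On0 adjoint X)"
    if [simp]: "X \<in> Ob0 M" for X
  proof -
    let ?RX = "R X" and ?LRX = "On0 L (R X)"
    \<comment> \<open>The second triangle identity is tested under \<open>post1\<close>: the
      composite and the identity both go to \<open>\<epsilon> X\<close>.\<close>
    have "post1 ?RX X (comp1 K ?RX (R ?LRX) ?RX (on1 adjoint ?LRX X (\<epsilon> X)) (adjunit ?RX))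
        = comp1 M ?LRX (On0 L (R ?LRX)) X (comp1 M (On0 L (R ?LRX)) ?LRX X (\<epsilon> X) (\<epsilon> ?LRX))
            (on1 L ?RX (R ?LRX) (adjunit ?RX))"
      by (simp add: adjunit post1_comp1 adjoint_on1)
    also have "\<dots> = comp1 M ?LRX ?LRX X (\<epsilon> X) (post1 ?RX ?LRX (adjunit ?RX))"
      by (simp add: adjunit(1) post1_def F.L.comp1_comp1)
    also have "\<dots> = post1 ?RX X (id1 K ?RX)"
      by (simp add: adjunit post1_def[of _ X] F.on1_id1)
    finally show ?thesis
      by (auto intro!: post1_inject[of ?RX X] simp: adjunit adjoint_on1)
  qed
qed

lemma has_right_adjoint: "has_right_adjoint K M L"
  using dagger_2_adjunction by (auto simp: has_right_adjoint_def)

end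

section \<open>The dagger 2-category of small dagger categories\<close>

lemma dagger_functors_iff:
  "F \<in> dagger_functors C D \<longleftrightarrow>
    dagger_functor C D F \<and> FOb F \<in> extensional (Ob C) \<and> FAr F \<in> extensional (Ar C)"
  by (simp add: dagger_functors_def)

lemma natural_transformation_cells:
  assumes "natural_transformation C D F G \<alpha>" "A \<in> Ob C"
  shows "\<alpha> A \<in> Ar D" "Dom D (\<alpha> A) = FOb F A" "Cod D (\<alpha> A) = FOb G A"
  using assms by (auto simp: natural_transformation_def arrows_def)

lemma natural_transformation_natural:
  assumes "natural_transformation C D F G \<alpha>" "f \<in> Ar C" "Dom C f = A" "Cod C f = B"
  shows "Cmp D (\<alpha> B) (FAr F f) = Cmp D (FAr G f) (\<alpha> A)"
  using assms by (auto simp: natural_transformation_def)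

lemma natural_transformation_extensional:
  "natural_transformation C D F G \<alpha> \<Longrightarrow> \<alpha> \<in> extensional (Ob C)"
  by (simp add: natural_transformation_def)

lemma natural_transformation_id:
  assumes "dagger_functor C D F"
  shows "natural_transformation C D F F (\<lambda>A\<in>Ob C. Ident D (FOb F A))"
proof -
  interpret dagger_functor C D F by fact
  show ?thesis
    by (auto simp: natural_transformation_def arrows_def C.cat_simps D.cat_simps functor_simps)
qed

lemma natural_transformation_vert:
  assumes \<alpha>: "natural_transformation C D F G \<alpha>" and \<beta>: "natural_transformation C D G H \<beta>"
    and "dagger_functor C D F" "dagger_functor C D G" "dagger_functor C D H"
  shows "natural_transformation C D F H (\<lambda>A\<in>Ob C. Cmp D (\<beta> A) (\<alpha> A))"
proof -
  interpret F: dagger_functor C D F by fact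
  interpret G: dagger_functor C D G by fact
  interpret H: dagger_functor C D H by fact
  note [simp] = F.C.cat_simps F.D.cat_simps F.functor_simps G.functor_simps H.functor_simps
    natural_transformation_cells[OF \<alpha>] natural_transformation_cells[OF \<beta>]
  have "Cmp D (Cmp D (\<beta> (Cod C f)) (\<alpha> (Cod C f))) (FAr F f)
      = Cmp D (FAr H f) (Cmp D (\<beta> (Dom C f)) (\<alpha> (Dom C f)))" if [simp]: "f \<in> Ar C" for f
  proof -
    have "Cmp D (Cmp D (\<beta> (Cod C f)) (\<alpha> (Cod C f))) (FAr F f)
        = Cmp D (\<beta> (Cod C f)) (Cmp D (FAr G f) (\<alpha> (Dom C f)))"
      using natural_transformation_natural[OF \<alpha> that] by simp
    also have "\<dots> = Cmp D (Cmp D (\<beta> (Cod C f)) (FAr G f)) (\<alpha> (Dom C f))"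
      by simp
    also have "\<dots> = Cmp D (FAr H f) (Cmp D (\<beta> (Dom C f)) (\<alpha> (Dom C f)))"
      unfolding natural_transformation_natural[OF \<beta> that refl refl] by simp
    finally show ?thesis .
  qed
  then show ?thesis
    by (auto simp: natural_transformation_def arrows_def)
qed

text \<open>The dagger of the naturality square at \<open>Dag C f\<close> is the square required at
  \<open>f\<close>, because \<open>F\<close> and \<open>G\<close> commute with daggers.\<close>

lemma natural_transformation_dag:
  assumes "dagger_functor C D F" "dagger_functor C D G"
    and \<alpha>: "natural_transformation C D F G \<alpha>"
  shows "natural_transformation C D G F (\<lambda>A\<in>Ob C. Dag D (\<alpha> A))"
proof -
  interpret F: dagger_functor C D F by fact
  interpret G: dagger_functor C D G by fact
  note [simp] = F.C.cat_simps F.D.cat_simps F.functor_simps G.functor_simps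
    natural_transformation_cells[OF \<alpha>]
  have "Cmp D (Dag D (\<alpha> (Cod C f))) (FAr G f) = Cmp D (FAr F f) (Dag D (\<alpha> (Dom C f)))"
    if [simp]: "f \<in> Ar C" for f
  proof -
    have "Cmp D (\<alpha> (Dom C f)) (FAr F (Dag C f)) = Cmp D (FAr G (Dag C f)) (\<alpha> (Cod C f))"
      by (rule natural_transformation_natural[OF \<alpha>]) simp_all
    from arg_cong[OF this, of "Dag D"] show ?thesis
      by simp
  qed
  then show ?thesis
    by (auto simp: natural_transformation_def arrows_def)
qed

lemma dagger_category_functor_dagcat:
  assumes "dagger_category C" "dagger_category D"
  shows "dagger_category (functor_dagcat C D)"
proof -
  interpret C: dagger_category C by fact
  interpret D: dagger_category D by fact
  show ?thesis
    by unfold_locales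
      (auto simp: functor_dagcat_def arrows_def dagger_functors_iff D.cat_simps
        natural_transformation_cells dagger_functor.FOb_Ob
        intro!: natural_transformation_id natural_transformation_vert natural_transformation_dag
          restrict_ext extensionalityI[OF restrict_extensional natural_transformation_extensional])
qed

section \<open>Composition of dagger functors and the axioms for \<open>DagCat\<close>\<close>

lemma dagfun_comp_simps [simp]:
  "A \<in> Ob C \<Longrightarrow> FOb (dagfun_comp C G F) A = FOb G (FOb F A)"
  "f \<in> Ar C \<Longrightarrow> FAr (dagfun_comp C G F) f = FAr G (FAr F f)"
  by (simp_all add: dagfun_comp_def compose_eq)

lemma dagfun_id_simps [simp]:
  "A \<in> Ob C \<Longrightarrow> FOb (dagfun_id C) A = A"
  "f \<in> Ar C \<Longrightarrow> FAr (dagfun_id C) f = f"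
  by (simp_all add: dagfun_id_def)

lemma dagger_functor_dagfun_comp:
  assumes "dagger_functor D E G" "dagger_functor C D F"
  shows "dagger_functor C E (dagfun_comp C G F)"
proof -
  interpret G: dagger_functor D E G by fact
  interpret F: dagger_functor C D F by fact
  show ?thesis
    by unfold_locales (auto simp: arrows_def F.C.cat_simps F.functor_simps G.functor_simps)
qed

lemma dagfun_comp_in_dagger_functors:
  assumes "G \<in> dagger_functors D E" "F \<in> dagger_functors C D"
  shows "dagfun_comp C G F \<in> dagger_functors C E"
  using assms
  unfolding dagger_functors_iff
  by (intro conjI dagger_functor_dagfun_comp) (auto simp: dagfun_comp_def)

lemma dagfun_id_in_dagger_functors:
  assumes "dagger_category C"
  shows "dagfun_id C \<in> dagger_functors C C"
proof -
  interpret dagger_category C by fact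
  have "dagger_functor C C (dagfun_id C)"
    by unfold_locales (auto simp: arrows_def cat_simps)
  then show ?thesis
    by (simp add: dagger_functors_iff dagfun_id_def)
qed

text \<open>Fixed values outside the domain turn pointwise agreement into equality of records; the
  strict associativity and unit laws for 1-cells rest on this.\<close>

lemma dagfun_eqI:
  assumes "F \<in> dagger_functors C D" "G \<in> dagger_functors C D"
    and "\<And>A. A \<in> Ob C \<Longrightarrow> FOb F A = FOb G A" "\<And>f. f \<in> Ar C \<Longrightarrow> FAr F f = FAr G f"
  shows "F = G"
  using assms by (intro dagfun.equality) (auto simp: dagger_functors_iff intro!: extensionalityI)

lemma natural_transformation_horiz:
  assumes "dagger_functor C D F" "dagger_functor C D F'" "dagger_functor D E G" "dagger_functor D E G'"
    and \<alpha>: "natural_transformation C D F F' \<alpha>" and \<beta>: "natural_transformation D E G G' \<beta>"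
  shows "natural_transformation C E (dagfun_comp C G F) (dagfun_comp C G' F')
    (\<lambda>A\<in>Ob C. Cmp E (\<beta> (FOb F' A)) (FAr G (\<alpha> A)))"
proof -
  interpret F: dagger_functor C D F by fact
  interpret F': dagger_functor C D F' by fact
  interpret G: dagger_functor D E G by fact
  interpret G': dagger_functor D E G' by fact
  note [simp] = F.C.cat_simps F.D.cat_simps G.D.cat_simps F.functor_simps G.functor_simps
    F'.functor_simps G'.functor_simps
    natural_transformation_cells[OF \<alpha>] natural_transformation_cells[OF \<beta>]
  have "Cmp E (Cmp E (\<beta> (FOb F' (Cod C f))) (FAr G (\<alpha> (Cod C f)))) (FAr G (FAr F f))
      = Cmp E (FAr G' (FAr F' f)) (Cmp E (\<beta> (FOb F' (Dom C f))) (FAr G (\<alpha> (Dom C f))))"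
    (is "?lhs = ?rhs") if [simp]: "f \<in> Ar C" for f
  proof -
    have "?lhs = Cmp E (\<beta> (FOb F' (Cod C f))) (FAr G (Cmp D (\<alpha> (Cod C f)) (FAr F f)))"
      by simp
    also have "\<dots> = Cmp E (Cmp E (\<beta> (FOb F' (Cod C f))) (FAr G (FAr F' f))) (FAr G (\<alpha> (Dom C f)))"
      unfolding natural_transformation_natural[OF \<alpha> that refl refl] by simp
    also have "Cmp E (\<beta> (FOb F' (Cod C f))) (FAr G (FAr F' f))
        = Cmp E (FAr G' (FAr F' f)) (\<beta> (FOb F' (Dom C f)))"
      by (rule natural_transformation_natural[OF \<beta>]) simp_all
    also have "Cmp E \<dots> (FAr G (\<alpha> (Dom C f))) = ?rhs"
      by simp
    finally show ?thesis .
  qed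
  then show ?thesis
    by (auto simp: natural_transformation_def arrows_def)
qed

lemma DagCat_simps [simp]:
  "Ob0 (DagCat small) = {C. small_dagger_category small C}"
  "Hom (DagCat small) = functor_dagcat"
  by (simp_all add: DagCat_def)

lemma dagger_functor_DagCat_HComp:
  assumes "dagger_category C" "dagger_category D" "dagger_category E"
  shows "dagger_functor (prod_dagcat (functor_dagcat D E) (functor_dagcat C D)) (functor_dagcat C E)
    (HComp (DagCat small) C D E)"
proof (intro dagger_functor.intro dagger_functor_axioms.intro dagger_category_prod
    dagger_category_functor_dagcat assms)
  interpret C: dagger_category C by fact
  interpret D: dagger_category D by fact
  interpret E: dagger_category E by fact
  note [simp] = C.cat_simps D.cat_simps E.cat_simps natural_transformation_cells
    dagger_functor.functor_simps dagger_functors_iff[THEN iffD1, THEN conjunct1]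
  let ?H = "HComp (DagCat small) C D E"
    and ?P = "prod_dagcat (functor_dagcat D E) (functor_dagcat C D)"
  show "FOb ?H P \<in> Ob (functor_dagcat C E)" if "P \<in> Ob ?P" for P
    using that by (auto simp: DagCat_def prod_dagcat_def functor_dagcat_def dagfun_comp_in_dagger_functors)
  show "FAr ?H p \<in> arrows (functor_dagcat C E) (FOb ?H P) (FOb ?H Q)" if "p \<in> arrows ?P P Q" for p P Q
    using that by (auto simp: DagCat_def prod_dagcat_def functor_dagcat_def arrows_def
        intro!: dagfun_comp_in_dagger_functors natural_transformation_horiz)
  show "FAr ?H (Ident ?P P) = Ident (functor_dagcat C E) (FOb ?H P)" if "P \<in> Ob ?P" for P
    using that by (auto simp: DagCat_def prod_dagcat_def functor_dagcat_def dagger_functors_iff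
        intro!: restrict_ext)
  show "FAr ?H (Cmp ?P q p) = Cmp (functor_dagcat C E) (FAr ?H q) (FAr ?H p)"
    if "p \<in> arrows ?P P Q" "q \<in> arrows ?P Q S" for p q P Q S
  proof -
    from that obtain F G H F' G' H' \<alpha> \<alpha>' \<beta> \<beta>' where p: "p = ((F', G', \<beta>), (F, G, \<alpha>))"
      and q: "q = ((G', H', \<beta>'), (G, H, \<alpha>'))"
      and fs: "dagger_functor C D F" "dagger_functor C D G" "dagger_functor C D H"
        "dagger_functor D E F'" "dagger_functor D E G'" "dagger_functor D E H'"
      and nat: "natural_transformation C D F G \<alpha>" "natural_transformation C D G H \<alpha>'"
        "natural_transformation D E F' G' \<beta>" "natural_transformation D E G' H' \<beta>'"
      by (auto simp: prod_dagcat_def functor_dagcat_def arrows_def dagger_functors_iff)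
    note [simp] = nat[THEN natural_transformation_cells(1)] nat[THEN natural_transformation_cells(2)]
      nat[THEN natural_transformation_cells(3)]
    have "Cmp E (Cmp E (\<beta>' (FOb H A)) (\<beta> (FOb H A))) (FAr F' (Cmp D (\<alpha>' A) (\<alpha> A)))
        = Cmp E (Cmp E (\<beta>' (FOb H A)) (FAr G' (\<alpha>' A))) (Cmp E (\<beta> (FOb G A)) (FAr F' (\<alpha> A)))"
      (is "?lhs = ?rhs") if [simp]: "A \<in> Ob C" for A
    proof -
      have "?lhs = Cmp E (\<beta>' (FOb H A)) (Cmp E (Cmp E (\<beta> (FOb H A)) (FAr F' (\<alpha>' A))) (FAr F' (\<alpha> A)))"
        using fs by simp
      \<comment> \<open>Interchange comes from naturality of \<open>\<beta>\<close> at the arrow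
        \<open>\<alpha>' A\<close>.\<close>
      also have "Cmp E (\<beta> (FOb H A)) (FAr F' (\<alpha>' A)) = Cmp E (FAr G' (\<alpha>' A)) (\<beta> (FOb G A))"
        by (rule natural_transformation_natural[OF nat(3)]) (use fs in simp_all)
      also have "Cmp E (\<beta>' (FOb H A)) (Cmp E \<dots> (FAr F' (\<alpha> A))) = ?rhs"
        using fs by simp
      finally show ?thesis .
    qed
    with fs show ?thesis
      by (auto simp: p q DagCat_def prod_dagcat_def functor_dagcat_def intro!: restrict_ext)
  qed
  show "FAr ?H (Dag ?P p) = Dag (functor_dagcat C E) (FAr ?H p)" if "p \<in> Ar ?P" for p
  proof -
    from that obtain F G F' G' \<alpha> \<beta> where p: "p = ((F', G', \<beta>), (F, G, \<alpha>))"
      and fs: "dagger_functor C D F" "dagger_functor C D G"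
        "dagger_functor D E F'" "dagger_functor D E G'"
      and nat: "natural_transformation C D F G \<alpha>" "natural_transformation D E F' G' \<beta>"
      by (auto simp: prod_dagcat_def functor_dagcat_def dagger_functors_iff)
    note [simp] = nat[THEN natural_transformation_cells(1)] nat[THEN natural_transformation_cells(2)]
      nat[THEN natural_transformation_cells(3)]
    have "Cmp E (Dag E (\<beta> (FOb F A))) (FAr G' (Dag D (\<alpha> A)))
        = Dag E (Cmp E (\<beta> (FOb G A)) (FAr F' (\<alpha> A)))" if [simp]: "A \<in> Ob C" for A
    proof -
      \<comment> \<open>A horizontal composite has two forms, by naturality of
        \<open>\<beta>\<close> at \<open>\<alpha> A\<close>. Taking the dagger reverses the order of
        the factors, so the dagger of the second form has the shape of the first.\<close>
      have "Cmp E (\<beta> (FOb G A)) (FAr F' (\<alpha> A)) = Cmp E (FAr G' (\<alpha> A)) (\<beta> (FOb F A))"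
        by (rule natural_transformation_natural[OF nat(2)]) (use fs in simp_all)
      then show ?thesis
        using fs by simp
    qed
    with fs show ?thesis
      by (auto simp: p DagCat_def prod_dagcat_def functor_dagcat_def intro!: restrict_ext)
  qed
qed

lemma dagger_functor_DagCat_HUnit:
  assumes "dagger_category C"
  shows "dagger_functor terminal_dagcat (functor_dagcat C C) (HUnit (DagCat small) C)"
proof (intro dagger_functor.intro dagger_functor_axioms.intro dagger_category_functor_dagcat assms)
  show "dagger_category terminal_dagcat"
    by unfold_locales (auto simp: terminal_dagcat_def arrows_def)
  interpret dagger_category C by fact
  note id = dagfun_id_in_dagger_functors[OF assms]
  have "natural_transformation C C (dagfun_id C) (dagfun_id C) (\<lambda>A\<in>Ob C. Ident C A)"
    by (auto simp: natural_transformation_def arrows_def cat_simps)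
  then show "FAr (HUnit (DagCat small) C) f \<in> arrows (functor_dagcat C C)
      (FOb (HUnit (DagCat small) C) A) (FOb (HUnit (DagCat small) C) B)" for f A B
    using id by (auto simp: DagCat_def functor_dagcat_def arrows_def)
qed (use dagfun_id_in_dagger_functors[OF assms] assms in
  \<open>auto simp: DagCat_def functor_dagcat_def dagger_category.cat_simps intro!: restrict_ext\<close>)

lemma dagger_2_category_DagCat: "dagger_2_category (DagCat small)"
proof (rule dagger_2_category.intro)
  have dc: "dagger_category C" if "C \<in> Ob0 (DagCat small)" for C
    using that by (simp add: small_dagger_category_def)
  note [simp] = dagger_category.cat_simps[OF dc] natural_transformation_cells
    dagger_functor.functor_simps
  show "dagger_category (Hom (DagCat small) C D)"
    if "C \<in> Ob0 (DagCat small)" "D \<in> Ob0 (DagCat small)" for C D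
    using that[THEN dc] by (simp add: dagger_category_functor_dagcat)
  show "dagger_functor (prod_dagcat (Hom (DagCat small) D E) (Hom (DagCat small) C D))
      (Hom (DagCat small) C E) (HComp (DagCat small) C D E)"
    if "C \<in> Ob0 (DagCat small)" "D \<in> Ob0 (DagCat small)" "E \<in> Ob0 (DagCat small)" for C D E
    using dagger_functor_DagCat_HComp[OF that[THEN dc]] by simp
  show "dagger_functor terminal_dagcat (Hom (DagCat small) C C) (HUnit (DagCat small) C)"
    if "C \<in> Ob0 (DagCat small)" for C
    using dagger_functor_DagCat_HUnit[OF that[THEN dc]] by simp
  show "comp1 (DagCat small) A C D H (comp1 (DagCat small) A B C G F)
      = comp1 (DagCat small) A B D (comp1 (DagCat small) B C D H G) F"
    if "F \<in> Ob (Hom (DagCat small) A B)" "G \<in> Ob (Hom (DagCat small) B C)"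
      "H \<in> Ob (Hom (DagCat small) C D)" for A B C D F G H
  proof -
    have "dagger_functor A B F" "dagger_functor B C G" "dagger_functor C D H"
      using that by (simp_all add: functor_dagcat_def dagger_functors_iff)
    then show ?thesis
      using that by (auto simp: DagCat_def functor_dagcat_def
          intro!: dagfun_eqI[where C = A and D = D] dagfun_comp_in_dagger_functors)
  qed
  show "comp1 (DagCat small) A B B (id1 (DagCat small) B) F = F"
    "comp1 (DagCat small) A A B F (id1 (DagCat small) A) = F"
    if "A \<in> Ob0 (DagCat small)" "B \<in> Ob0 (DagCat small)" "F \<in> Ob (Hom (DagCat small) A B)" for A B F
  proof -
    have "dagger_functor A B F"
      using that by (simp add: functor_dagcat_def dagger_functors_iff)
    then show "comp1 (DagCat small) A B B (id1 (DagCat small) B) F = F"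
      "comp1 (DagCat small) A A B F (id1 (DagCat small) A) = F"
      using that that(1,2)[THEN dc] by (auto simp: DagCat_def functor_dagcat_def
          intro!: dagfun_eqI[where C = A and D = B] dagfun_comp_in_dagger_functors
            dagfun_id_in_dagger_functors)
  qed
  show "horiz (DagCat small) A C D \<chi> (horiz (DagCat small) A B C \<psi> \<phi>)
      = horiz (DagCat small) A B D (horiz (DagCat small) B C D \<chi> \<psi>) \<phi>"
    if asm: "A \<in> Ob0 (DagCat small)" "B \<in> Ob0 (DagCat small)" "C \<in> Ob0 (DagCat small)"
      "D \<in> Ob0 (DagCat small)" "\<phi> \<in> Ar (Hom (DagCat small) A B)" "\<psi> \<in> Ar (Hom (DagCat small) B C)"
      "\<chi> \<in> Ar (Hom (DagCat small) C D)" for A B C D \<phi> \<psi> \<chi>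
  proof -
    obtain F F' \<alpha> where \<phi>: "\<phi> = (F, F', \<alpha>)" "F \<in> dagger_functors A B" "F' \<in> dagger_functors A B"
      and \<alpha>: "natural_transformation A B F F' \<alpha>"
      using asm(5) by (auto simp: functor_dagcat_def)
    obtain G G' \<beta> where \<psi>: "\<psi> = (G, G', \<beta>)" "G \<in> dagger_functors B C" "G' \<in> dagger_functors B C"
      and \<beta>: "natural_transformation B C G G' \<beta>"
      using asm(6) by (auto simp: functor_dagcat_def)
    obtain H H' \<gamma> where \<chi>: "\<chi> = (H, H', \<gamma>)" "H \<in> dagger_functors C D" "H' \<in> dagger_functors C D"
      and \<gamma>: "natural_transformation C D H H' \<gamma>"
      using asm(7) by (auto simp: functor_dagcat_def)
    have fs: "dagger_functor A B F" "dagger_functor A B F'" "dagger_functor B C G"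
      "dagger_functor B C G'" "dagger_functor C D H" "dagger_functor C D H'"
      using \<phi> \<psi> \<chi> by (simp_all add: dagger_functors_iff)
    show ?thesis
      using \<phi> \<psi> \<chi> \<alpha> \<beta> \<gamma> fs asm(1-4)
      by (auto simp: DagCat_def intro!: dagfun_eqI[where C = A and D = D] dagfun_comp_in_dagger_functors
          restrict_ext)
  qed
  show "horiz (DagCat small) A B B (FAr (HUnit (DagCat small) B) ()) \<phi> = \<phi>"
    "horiz (DagCat small) A A B \<phi> (FAr (HUnit (DagCat small) A) ()) = \<phi>"
    if asm: "A \<in> Ob0 (DagCat small)" "B \<in> Ob0 (DagCat small)" "\<phi> \<in> Ar (Hom (DagCat small) A B)" for A B \<phi>
  proof -
    obtain F F' \<alpha> where \<phi>: "\<phi> = (F, F', \<alpha>)" "F \<in> dagger_functors A B" "F' \<in> dagger_functors A B"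
      and \<alpha>: "natural_transformation A B F F' \<alpha>"
      using asm(3) by (auto simp: functor_dagcat_def)
    have fs: "dagger_functor A B F" "dagger_functor A B F'"
      using \<phi> by (simp_all add: dagger_functors_iff)
    show "horiz (DagCat small) A B B (FAr (HUnit (DagCat small) B) ()) \<phi> = \<phi>"
      "horiz (DagCat small) A A B \<phi> (FAr (HUnit (DagCat small) A) ()) = \<phi>"
      using \<phi> \<alpha> fs asm(1,2) asm(1,2)[THEN dc]
      by (auto simp: DagCat_def intro!: dagfun_eqI[where C = A and D = B] dagfun_comp_in_dagger_functors
          dagfun_id_in_dagger_functors
          extensionalityI[OF restrict_extensional natural_transformation_extensional])
  qed
qed

section \<open>FEM-algebras\<close>

context dagger_2_category
begin

lemma inclusion_components [simp]:
  "Base (On0 (DFMonad_inclusion K) A) = A"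
  "Endo (On0 (DFMonad_inclusion K) A) = id1 K A"
  "Unt (On0 (DFMonad_inclusion K) A) = id2 K A A (id1 K A)"
  "Mult (On0 (DFMonad_inclusion K) A) = id2 K A A (id1 K A)"
  by (simp_all add: DFMonad_inclusion_def)

text \<open>The source monad is an identity, so its multiplication and all whiskerings by its
  endomorphism drop out. What remains are the unit, associativity and Frobenius laws of an algebra,
  for the 1-cell \<open>F\<close> in place of an object.\<close>

lemma dfm_morphism_inclusion_iff:
  assumes "A \<in> Ob0 K" "dagger_frobenius_monad K X"
  shows "dfm_morphism K (On0 (DFMonad_inclusion K) A) X (F, \<sigma>) \<longleftrightarrow>
    F \<in> Ob (Hom K A (Base X)) \<and> \<sigma> \<in> Ar (Hom K A (Base X)) \<and>
    Dom (Hom K A (Base X)) \<sigma> = comp1 K A (Base X) (Base X) (Endo X) F \<and>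
    Cod (Hom K A (Base X)) \<sigma> = F \<and>
    vert K A (Base X) \<sigma> (rwh K A (Base X) (Base X) (Unt X) F) = id2 K A (Base X) F \<and>
    vert K A (Base X) \<sigma> (rwh K A (Base X) (Base X) (Mult X) F)
      = vert K A (Base X) \<sigma> (lwh K A (Base X) (Base X) (Endo X) \<sigma>) \<and>
    vert K A (Base X) (dag2 K A (Base X) \<sigma>) \<sigma>
      = vert K A (Base X) (rwh K A (Base X) (Base X) (Mult X) F)
          (lwh K A (Base X) (Base X) (Endo X) (dag2 K A (Base X) \<sigma>))"
  using assms by (auto simp: dfm_morphism_iff)

lemma dfm_square_inclusion_iff:
  assumes "A \<in> Ob0 K" "\<phi> \<in> Ar (Hom K A (Base X))" "Base X \<in> Ob0 K"
  shows "dfm_square K (On0 (DFMonad_inclusion K) A) X \<sigma> \<tau> \<phi> \<longleftrightarrow>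
    vert K A (Base X) \<tau> (lwh K A (Base X) (Base X) (Endo X) \<phi>) = vert K A (Base X) \<phi> \<sigma>"
  using assms by (simp add: dfm_square_def)

end

text \<open>
  An algebra is represented by its structure map \<open>a\<close>; its carrier is \<open>Cod C a\<close>.
\<close>

definition fem_algebra ::
    "(('o, 'a) dagcat, ('o, 'a, 'o, 'a) dagfun, ('o, 'a, 'o, 'a) nattrans) dfmonad \<Rightarrow> 'a \<Rightarrow> bool" where
  "fem_algebra X a \<longleftrightarrow>
    (let C = Base X; T = Endo X; A = Cod C a; \<eta> = snd (snd (Unt X)); \<mu> = snd (snd (Mult X)) in
      a \<in> Ar C \<and> Dom C a = FOb T A \<and>
      Cmp C a (\<eta> A) = Ident C A \<and>
      Cmp C a (\<mu> A) = Cmp C a (FAr T a) \<and>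
      Cmp C (Dag C a) a = Cmp C (\<mu> A) (FAr T (Dag C a)))"

definition fem_hom ::
    "(('o, 'a) dagcat, ('o, 'a, 'o, 'a) dagfun, ('o, 'a, 'o, 'a) nattrans) dfmonad
      \<Rightarrow> 'a \<Rightarrow> 'a \<Rightarrow> 'a \<Rightarrow> bool" where
  "fem_hom X a b f \<longleftrightarrow>
    (let C = Base X; T = Endo X in
      f \<in> arrows C (Cod C a) (Cod C b) \<and>
      Cmp C b (FAr T f) = Cmp C f a \<and>
      Cmp C a (FAr T (Dag C f)) = Cmp C (Dag C f) b)"

definition fem_homs where
  "fem_homs X = {(a, b, f). fem_algebra X a \<and> fem_algebra X b \<and> fem_hom X a b f}"

text \<open>
  An arrow of \<open>C\<close> may be a homomorphism between several pairs of algebras, so it is tagged with its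
  source and target; \<open>enc\<close> codes the tagged arrows by elements of the universe on which smallness is
  defined.
\<close>

definition FEM ::
    "('a \<times> 'a \<times> 'a \<Rightarrow> 'e)
      \<Rightarrow> (('o, 'a) dagcat, ('o, 'a, 'o, 'a) dagfun, ('o, 'a, 'o, 'a) nattrans) dfmonad
      \<Rightarrow> ('a, 'e) dagcat" where
  "FEM enc X =
    (let C = Base X; dec = inv enc; src = (\<lambda>x. fst (dec x)); tgt = (\<lambda>x. fst (snd (dec x)));
         und = (\<lambda>x. snd (snd (dec x))); H = enc ` fem_homs X in
      \<lparr>Ob = {a. fem_algebra X a}, Ar = H, Dom = restrict src H, Cod = restrict tgt H,
       Ident = (\<lambda>a\<in>{a. fem_algebra X a}. enc (a, a, Ident C (Cod C a))),
       Cmp = (\<lambda>y x. if y \<in> H \<and> x \<in> H \<and> src y = tgt x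
                    then enc (src x, tgt y, Cmp C (und y) (und x)) else undefined),
       Dag = (\<lambda>x\<in>H. enc (tgt x, src x, Dag C (und x)))\<rparr>)"

definition fem_forget where
  "fem_forget enc X =
    \<lparr>FOb = restrict (Cod (Base X)) (Ob (FEM enc X)),
     FAr = (\<lambda>x\<in>Ar (FEM enc X). snd (snd (inv enc x)))\<rparr>"

text \<open>Since the objects of \<open>FEM enc X\<close> are structure maps, the tautological
  family is the identity function, restricted to the objects.\<close>

definition fem_counit where
  "fem_counit enc X =
    (fem_forget enc X,
     (dagfun_comp (FEM enc X) (Endo X) (fem_forget enc X), fem_forget enc X,
      \<lambda>a\<in>Ob (FEM enc X). a))"

section \<open>The dagger category of FEM-algebras of a fixed monad\<close>

locale fem =
  fixes small :: "'u set \<Rightarrow> bool" and enc :: "'u \<times> 'u \<times> 'u \<Rightarrow> 'u"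
    and X :: "(('u, 'u) dagcat, ('u, 'u, 'u, 'u) dagfun, ('u, 'u, 'u, 'u) nattrans) dfmonad"
  assumes small: "smallness small"
    and inj_enc: "inj enc"
    and X: "dagger_frobenius_monad (DagCat small) X"
begin

abbreviation "C \<equiv> Base X"
abbreviation "T \<equiv> Endo X"
abbreviation "\<eta> \<equiv> snd (snd (Unt X))"
abbreviation "\<mu> \<equiv> snd (snd (Mult X))"

lemma small_C: "small_dagger_category small C"
  using dagger_2_category.dfm_cells(1)[OF dagger_2_category_DagCat X] by simp

lemma T: "T \<in> dagger_functors C C"
  using dagger_2_category.dfm_cells(2)[OF dagger_2_category_DagCat X] by (simp add: functor_dagcat_def)

sublocale T: dagger_functor C C T
  using T by (simp add: dagger_functors_iff)

lemmas C_simps [simp] = T.C.cat_simps T.functor_simps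

lemma unit:
  "Unt X = (dagfun_id C, T, \<eta>)" "natural_transformation C C (dagfun_id C) T \<eta>"
proof -
  have "Unt X \<in> Ar (functor_dagcat C C)" "Dom (functor_dagcat C C) (Unt X) = dagfun_id C"
    "Cod (functor_dagcat C C) (Unt X) = T"
    using dagger_2_category.dfm_cells(3-5)[OF dagger_2_category_DagCat X] by (simp_all add: DagCat_def)
  then show "Unt X = (dagfun_id C, T, \<eta>)" "natural_transformation C C (dagfun_id C) T \<eta>"
    by (auto simp: functor_dagcat_def)
qed

lemma mult:
  "Mult X = (dagfun_comp C T T, T, \<mu>)" "natural_transformation C C (dagfun_comp C T T) T \<mu>"
proof -
  have "Mult X \<in> Ar (functor_dagcat C C)" "Dom (functor_dagcat C C) (Mult X) = dagfun_comp C T T"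
    "Cod (functor_dagcat C C) (Mult X) = T"
    using dagger_2_category.dfm_cells(6-8)[OF dagger_2_category_DagCat X] by (simp_all add: DagCat_def)
  then show "Mult X = (dagfun_comp C T T, T, \<mu>)" "natural_transformation C C (dagfun_comp C T T) T \<mu>"
    by (auto simp: functor_dagcat_def)
qed

lemma unit_mult_cells [simp]:
  assumes "A \<in> Ob C"
  shows "\<eta> A \<in> Ar C" "Dom C (\<eta> A) = A" "Cod C (\<eta> A) = FOb T A"
    and "\<mu> A \<in> Ar C" "Dom C (\<mu> A) = FOb T (FOb T A)" "Cod C (\<mu> A) = FOb T A"
  using natural_transformation_cells[OF unit(2) assms] natural_transformation_cells[OF mult(2) assms] assms
  by simp_all

lemma fem_algebra_cells [simp]:
  assumes "fem_algebra X a"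
  shows "a \<in> Ar C" "Dom C a = FOb T (Cod C a)"
  using assms by (simp_all add: fem_algebra_def Let_def)

lemma fem_hom_iff:
  "fem_hom X a b f \<longleftrightarrow> f \<in> Ar C \<and> Dom C f = Cod C a \<and> Cod C f = Cod C b \<and>
    Cmp C b (FAr T f) = Cmp C f a \<and> Cmp C a (FAr T (Dag C f)) = Cmp C (Dag C f) b"
  by (auto simp: fem_hom_def Let_def arrows_def)

lemma fem_hom_id: "fem_algebra X a \<Longrightarrow> fem_hom X a a (Ident C (Cod C a))"
  by (simp add: fem_hom_iff)

lemma fem_hom_cmp:
  assumes [simp]: "fem_algebra X a" "fem_algebra X b" "fem_algebra X c"
    and f: "fem_hom X a b f" and g: "fem_hom X b c g"
  shows "fem_hom X a c (Cmp C g f)"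
proof -
  have [simp]: "f \<in> Ar C" "Dom C f = Cod C a" "Cod C f = Cod C b"
    "g \<in> Ar C" "Dom C g = Cod C b" "Cod C g = Cod C c"
    using f g by (auto simp: fem_hom_iff)
  have "Cmp C c (FAr T (Cmp C g f)) = Cmp C (Cmp C c (FAr T g)) (FAr T f)"
    by simp
  also have "\<dots> = Cmp C g (Cmp C b (FAr T f))"
    using g by (simp add: fem_hom_iff del: T.FAr_of_Cmp)
  also have "\<dots> = Cmp C (Cmp C g f) a"
    using f by (simp add: fem_hom_iff)
  finally have 1: "Cmp C c (FAr T (Cmp C g f)) = Cmp C (Cmp C g f) a" .
  \<comment> \<open>\<open>T.FAr_Dag\<close> is switched off here so that
    \<open>FAr T (Dag C f)\<close> keeps the shape in which the second homomorphism law is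
    stated.\<close>
  have "Cmp C a (FAr T (Dag C (Cmp C g f))) = Cmp C (Cmp C a (FAr T (Dag C f))) (FAr T (Dag C g))"
    by (simp del: T.FAr_Dag)
  also have "\<dots> = Cmp C (Dag C f) (Cmp C b (FAr T (Dag C g)))"
    using f by (simp add: fem_hom_iff del: T.FAr_Dag)
  also have "\<dots> = Cmp C (Dag C (Cmp C g f)) c"
    using g by (simp add: fem_hom_iff del: T.FAr_Dag)
  finally have 2: "Cmp C a (FAr T (Dag C (Cmp C g f))) = Cmp C (Dag C (Cmp C g f)) c" .
  show ?thesis
    unfolding fem_hom_iff using 1 2 by simp
qed

lemma fem_hom_dag: "fem_hom X a b f \<Longrightarrow> fem_hom X b a (Dag C f)"
  by (auto simp: fem_hom_iff)

abbreviation "E \<equiv> FEM enc X"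

lemma inv_enc [simp]: "inv enc (enc t) = t"
  by (rule inv_f_f[OF inj_enc])

lemma enc_eq [simp]: "enc s = enc t \<longleftrightarrow> s = t"
  by (rule inj_eq[OF inj_enc])

lemma Ob_FEM [simp]: "Ob E = {a. fem_algebra X a}"
  by (simp add: FEM_def Let_def)

lemma Ar_FEM [simp]:
  "enc (a, b, f) \<in> Ar E \<longleftrightarrow> fem_algebra X a \<and> fem_algebra X b \<and> fem_hom X a b f"
  by (auto simp: FEM_def Let_def fem_homs_def)

lemma Ar_FEM_E:
  assumes "x \<in> Ar E"
  obtains a b f where "x = enc (a, b, f)" "fem_algebra X a" "fem_algebra X b" "fem_hom X a b f"
  using assms by (auto simp: FEM_def Let_def fem_homs_def)

lemma Dom_Cod_Dag_FEM [simp]: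
  assumes "fem_algebra X a" "fem_algebra X b" "fem_hom X a b f"
  shows "Dom E (enc (a, b, f)) = a" "Cod E (enc (a, b, f)) = b"
    "Dag E (enc (a, b, f)) = enc (b, a, Dag C f)"
  using assms Ar_FEM[of a b f, THEN iffD2] by (simp_all add: FEM_def Let_def)

lemma Ident_FEM [simp]: "fem_algebra X a \<Longrightarrow> Ident E a = enc (a, a, Ident C (Cod C a))"
  by (simp add: FEM_def Let_def)

lemma Cmp_FEM [simp]:
  assumes "fem_algebra X a" "fem_algebra X b" "fem_algebra X c" "fem_hom X a b f" "fem_hom X b c g"
  shows "Cmp E (enc (b, c, g)) (enc (a, b, f)) = enc (a, c, Cmp C g f)"
  using assms Ar_FEM[of a b f, THEN iffD2] Ar_FEM[of b c g, THEN iffD2]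
  by (simp add: FEM_def Let_def)

lemma dagger_category_FEM: "dagger_category E"
proof
  note [simp] = arrows_def fem_hom_id fem_hom_cmp fem_hom_dag
  show "Dom E x \<in> Ob E" "Cod E x \<in> Ob E" "Dag E (Dag E x) = x" if "x \<in> Ar E" for x
    using that by (auto elim!: Ar_FEM_E simp: fem_hom_iff[of _ _ "Dag C (Dag C _)"])
      (auto simp: fem_hom_iff)
  show "Ident E a \<in> arrows E a a" "Dag E (Ident E a) = Ident E a" if "a \<in> Ob E" for a
    using that by auto
  show "Cmp E y x \<in> arrows E a c" "Dag E (Cmp E y x) = Cmp E (Dag E x) (Dag E y)"
    if "x \<in> arrows E a b" "y \<in> arrows E b c" for x y a b c
    using that by (auto elim!: Ar_FEM_E) (auto simp: fem_hom_iff)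
  show "Cmp E (Ident E b) x = x" "Cmp E x (Ident E a) = x" "Dag E x \<in> arrows E b a"
    if "x \<in> arrows E a b" for x a b
    using that by (auto elim!: Ar_FEM_E) (auto simp: fem_hom_iff)
  show "Cmp E z (Cmp E y x) = Cmp E (Cmp E z y) x"
    if "x \<in> arrows E a b" "y \<in> arrows E b c" "z \<in> arrows E c d" for x y z a b c d
    using that by (auto elim!: Ar_FEM_E) (auto simp: fem_hom_iff)
qed

text \<open>Objects are particular arrows of \<open>C\<close>, and arrows are coded triples of
  arrows of \<open>C\<close>, so everything is bounded by \<open>Ar C\<close> and its threefold
  product.\<close>

lemma small_dagger_category_FEM: "small_dagger_category small E"
proof -
  have small_C': "small (Ar C)"
    using small_C by (simp add: small_dagger_category_def)
  have sub: "small B" if "small A" "B \<lesssim> A" for A B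
    using small that unfolding smallness_def by blast
  have prod: "\<exists>P. small P \<and> P \<approx> A \<times> B" if "small A" "small B" for A B
    using small that unfolding smallness_def by blast
  have "small (Ob E)"
    by (rule sub[OF small_C'], rule subset_imp_lepoll) auto
  moreover have "small (Ar E)"
  proof -
    \<comment> \<open>The product is not a set over the base type; closure under products only gives
      a small set of its size, so a threefold product needs two such sets.\<close>
    obtain P where P: "small P" "P \<approx> Ar C \<times> Ar C"
      using prod[OF small_C' small_C'] by blast
    obtain Q where Q: "small Q" "Q \<approx> Ar C \<times> P"
      using prod[OF small_C' P(1)] by blast
    have "Ar E \<lesssim> fem_homs X"
      by (auto simp: FEM_def Let_def image_lepoll)
    also have "fem_homs X \<lesssim> Ar C \<times> (Ar C \<times> Ar C)"
      by (rule subset_imp_lepoll) (auto simp: fem_homs_def fem_hom_iff)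
    also have "Ar C \<times> (Ar C \<times> Ar C) \<approx> Ar C \<times> P"
      using P(2) by (intro times_eqpoll_cong eqpoll_refl) (rule eqpoll_sym)
    also have "Ar C \<times> P \<approx> Q"
      using Q(2) by (rule eqpoll_sym)
    finally show ?thesis
      by (rule sub[OF Q(1)])
  qed
  ultimately show ?thesis
    using dagger_category_FEM
    by (auto simp: small_dagger_category_def FEM_def Let_def)
qed

lemma fem_forget_simps [simp]:
  "fem_algebra X a \<Longrightarrow> FOb (fem_forget enc X) a = Cod C a"
  "\<lbrakk>fem_algebra X a; fem_algebra X b; fem_hom X a b f\<rbrakk> \<Longrightarrow> FAr (fem_forget enc X) (enc (a, b, f)) = f"
  by (simp_all add: fem_forget_def)

lemma fem_forget: "fem_forget enc X \<in> dagger_functors E C"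
proof -
  have "dagger_functor E C (fem_forget enc X)"
  proof (intro dagger_functor.intro dagger_functor_axioms.intro dagger_category_FEM T.C.dagger_category_axioms)
  qed (auto elim!: Ar_FEM_E simp: arrows_def fem_hom_id fem_hom_cmp fem_hom_dag, auto simp: fem_hom_iff)
  then show ?thesis
    by (simp add: dagger_functors_iff) (simp add: fem_forget_def)
qed

lemma restrict_eq_iff: "restrict f A = restrict g A \<longleftrightarrow> (\<forall>x\<in>A. f x = g x)"
  by (metis restrict_apply' restrict_ext)

abbreviation "K \<equiv> DagCat small"
abbreviation "incl \<equiv> DFMonad_inclusion K"

lemma dagger_functor_fem_forget: "dagger_functor E C (fem_forget enc X)"
  using fem_forget by (simp add: dagger_functors_iff)

section \<open>Monad morphisms from an included dagger category, read pointwise\<close>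

context
  fixes A :: "('u, 'u) dagcat"
  assumes A: "small_dagger_category small A"
begin

lemma A_dagcat: "dagger_category A"
  using A by (simp add: small_dagger_category_def)

lemmas A_simps [simp] = dagger_category.cat_simps[OF A_dagcat]

lemma dagfun_comp_unit:
  assumes "F \<in> dagger_functors A C"
  shows "dagfun_comp A (dagfun_id C) F = F"
proof -
  have "dagger_functor A C F"
    using assms by (simp add: dagger_functors_iff)
  then show ?thesis
    using assms dagfun_id_in_dagger_functors[OF T.C.dagger_category_axioms]
    by (intro dagfun_eqI[where C = A and D = C] dagfun_comp_in_dagger_functors)
      (auto simp: dagger_functor.functor_simps)
qed

lemma dagfun_comp_T_T:
  assumes "F \<in> dagger_functors A C"
  shows "dagfun_comp A T (dagfun_comp A T F) = dagfun_comp A (dagfun_comp C T T) F"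
proof -
  have "dagger_functor A C F"
    using assms by (simp add: dagger_functors_iff)
  then show ?thesis
    using assms T dagfun_comp_in_dagger_functors[OF T T] by (intro dagfun_eqI[where C = A and D = C] dagfun_comp_in_dagger_functors)
      (auto simp: dagger_functor.functor_simps)
qed

lemma lwh_T:
  assumes "\<And>B. B \<in> Ob A \<Longrightarrow> \<beta> B \<in> Ar C" "\<And>B. B \<in> Ob A \<Longrightarrow> Cod C (\<beta> B) = FOb H B"
  shows "lwh K A C C T (G, H, \<beta>) = (dagfun_comp A T G, dagfun_comp A T H, \<lambda>B\<in>Ob A. FAr T (\<beta> B))"
proof -
  have "FOb H B \<in> Ob C" if "B \<in> Ob A" for B
    using T.C.Cod_Ob[OF assms(1)[OF that]] assms(2)[OF that] by simp
  then show ?thesis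
    using assms by (auto simp: DagCat_def functor_dagcat_def restrict_eq_iff)
qed

text \<open>Equations of 2-cells in \<open>DagCat\<close> are equations of families restricted to
  \<open>Ob A\<close>. Evaluated at \<open>B\<close>, the three laws are those of
  \<open>fem_algebra\<close> for \<open>\<alpha> B\<close>, whose carrier is
  \<open>FOb F B\<close>.\<close>

lemma dfm_morphism_inclusion_DagCat_iff:
  "dfm_morphism K (On0 incl A) X (F, \<sigma>) \<longleftrightarrow>
    F \<in> dagger_functors A C \<and>
    (\<exists>\<alpha>. \<sigma> = (dagfun_comp A T F, F, \<alpha>) \<and>
      natural_transformation A C (dagfun_comp A T F) F \<alpha> \<and> (\<forall>B\<in>Ob A. fem_algebra X (\<alpha> B)))"
proof -
  have cells: "F \<in> Ob (Hom K A C) \<and> \<sigma> \<in> Ar (Hom K A C) \<and>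
      Dom (Hom K A C) \<sigma> = comp1 K A C C T F \<and> Cod (Hom K A C) \<sigma> = F \<longleftrightarrow>
      F \<in> dagger_functors A C \<and>
      (\<exists>\<alpha>. \<sigma> = (dagfun_comp A T F, F, \<alpha>) \<and> natural_transformation A C (dagfun_comp A T F) F \<alpha>)"
    using T by (auto simp: DagCat_def functor_dagcat_def dagfun_comp_in_dagger_functors)
  have laws: "vert K A C \<sigma> (rwh K A C C (Unt X) F) = id2 K A C F \<and>
      vert K A C \<sigma> (rwh K A C C (Mult X) F) = vert K A C \<sigma> (lwh K A C C T \<sigma>) \<and>
      vert K A C (dag2 K A C \<sigma>) \<sigma>
        = vert K A C (rwh K A C C (Mult X) F) (lwh K A C C T (dag2 K A C \<sigma>)) \<longleftrightarrow>
      (\<forall>B\<in>Ob A. fem_algebra X (\<alpha> B))"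
    if F: "F \<in> dagger_functors A C" and \<sigma>: "\<sigma> = (dagfun_comp A T F, F, \<alpha>)"
      and \<alpha>: "natural_transformation A C (dagfun_comp A T F) F \<alpha>" for \<alpha>
  proof -
    interpret F: dagger_functor A C F
      using F by (simp add: dagger_functors_iff)
    note [simp] = F.functor_simps natural_transformation_cells[OF \<alpha>]
    have unt: "rwh K A C C (Unt X) F = (F, dagfun_comp A T F, \<lambda>B\<in>Ob A. \<eta> (FOb F B))"
      by (subst unit) (auto simp: DagCat_def functor_dagcat_def dagfun_comp_unit[OF F] restrict_eq_iff)
    have mul: "rwh K A C C (Mult X) F
        = (dagfun_comp A T (dagfun_comp A T F), dagfun_comp A T F, \<lambda>B\<in>Ob A. \<mu> (FOb F B))"
      by (subst mult) (auto simp: DagCat_def functor_dagcat_def dagfun_comp_T_T[OF F] restrict_eq_iff)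
    have dag: "dag2 K A C \<sigma> = (F, dagfun_comp A T F, \<lambda>B\<in>Ob A. Dag C (\<alpha> B))"
      by (simp add: \<sigma> functor_dagcat_def)
    have T\<sigma>: "lwh K A C C T \<sigma>
        = (dagfun_comp A T (dagfun_comp A T F), dagfun_comp A T F, \<lambda>B\<in>Ob A. FAr T (\<alpha> B))"
      unfolding \<sigma> by (rule lwh_T) simp_all
    have Tdag: "lwh K A C C T (dag2 K A C \<sigma>)
        = (dagfun_comp A T F, dagfun_comp A T (dagfun_comp A T F), \<lambda>B\<in>Ob A. FAr T (Dag C (\<alpha> B)))"
      unfolding dag by (subst lwh_T) (simp_all add: restrict_eq_iff del: T.FAr_Dag)
    have "(\<forall>B\<in>Ob A. fem_algebra X (\<alpha> B)) \<longleftrightarrow>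
        (\<forall>B\<in>Ob A. Cmp C (\<alpha> B) (\<eta> (FOb F B)) = Ident C (FOb F B)) \<and>
        (\<forall>B\<in>Ob A. Cmp C (\<alpha> B) (\<mu> (FOb F B)) = Cmp C (\<alpha> B) (FAr T (\<alpha> B))) \<and>
        (\<forall>B\<in>Ob A. Cmp C (Dag C (\<alpha> B)) (\<alpha> B) = Cmp C (\<mu> (FOb F B)) (FAr T (Dag C (\<alpha> B))))"
      by (auto simp: fem_algebra_def Let_def simp del: T.FAr_Dag fem_algebra_cells)
    then show ?thesis
      \<comment> \<open>The order matters: the left side of \<open>Tdag\<close> contains
        \<open>dag2 K A C \<sigma>\<close>, and those of \<open>dag\<close> and
        \<open>T\<sigma>\<close> contain \<open>\<sigma>\<close>, so the larger terms are replaced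
        before their parts.\<close>
      unfolding Tdag unfolding T\<sigma> dag unt mul unfolding \<sigma>
      by (simp add: functor_dagcat_def restrict_eq_iff del: T.FAr_Dag)
  qed
  have "dagger_frobenius_monad K X" "A \<in> Ob0 K"
    using X A by simp_all
  then show ?thesis
    unfolding dagger_2_category.dfm_morphism_inclusion_iff[OF dagger_2_category_DagCat \<open>A \<in> Ob0 K\<close> X]
    using cells laws by blast
qed

text \<open>Pointwise, the square for \<open>\<phi>\<close> says that the component is a
  homomorphism, and the square for its dagger says the same of the dagger of the component.\<close>

lemma dfm_transformation_inclusion_DagCat_iff:
  assumes "dfm_morphism K (On0 incl A) X (F, (P, F', \<alpha>))" "dfm_morphism K (On0 incl A) X (G, (Q, G', \<beta>))"
  shows "dfm_transformation K (On0 incl A) X (F, (P, F', \<alpha>)) (G, (Q, G', \<beta>)) \<phi> \<longleftrightarrow>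
    (\<exists>\<gamma>. \<phi> = (F, G, \<gamma>) \<and> natural_transformation A C F G \<gamma> \<and>
      (\<forall>B\<in>Ob A. fem_hom X (\<alpha> B) (\<beta> B) (\<gamma> B)))"
proof -
  have F: "F \<in> dagger_functors A C" "P = dagfun_comp A T F" "F' = F"
    and \<alpha>: "natural_transformation A C (dagfun_comp A T F) F \<alpha>"
    and G: "G \<in> dagger_functors A C" "Q = dagfun_comp A T G" "G' = G"
    and \<beta>: "natural_transformation A C (dagfun_comp A T G) G \<beta>"
    using assms by (auto simp: dfm_morphism_inclusion_DagCat_iff)
  interpret F: dagger_functor A C F
    using F by (simp add: dagger_functors_iff)
  interpret G: dagger_functor A C G
    using G by (simp add: dagger_functors_iff)
  have cells: "\<phi> \<in> Ar (Hom K A C) \<and> Dom (Hom K A C) \<phi> = F \<and> Cod (Hom K A C) \<phi> = G \<longleftrightarrow>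
      (\<exists>\<gamma>. \<phi> = (F, G, \<gamma>) \<and> natural_transformation A C F G \<gamma>)"
    using F G by (auto simp: functor_dagcat_def)
  have squares: "dfm_square K (On0 incl A) X (P, F', \<alpha>) (Q, G', \<beta>) \<phi> \<and>
      dfm_square K (On0 incl A) X (Q, G', \<beta>) (P, F', \<alpha>) (dag2 K A C \<phi>) \<longleftrightarrow>
      (\<forall>B\<in>Ob A. fem_hom X (\<alpha> B) (\<beta> B) (\<gamma> B))"
    if \<phi>: "\<phi> = (F, G, \<gamma>)" and \<gamma>: "natural_transformation A C F G \<gamma>" for \<gamma>
  proof -
    note [simp] = F.functor_simps G.functor_simps natural_transformation_cells[OF \<alpha>]
      natural_transformation_cells[OF \<beta>] natural_transformation_cells[OF \<gamma>]
    have in_Hom: "\<phi> \<in> Ar (Hom K A C)" "dag2 K A C \<phi> \<in> Ar (Hom K A C)"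
      using \<phi> \<gamma> F G natural_transformation_dag[OF F.dagger_functor_axioms G.dagger_functor_axioms \<gamma>]
      by (simp_all add: functor_dagcat_def)
    have ob: "A \<in> Ob0 K" "C \<in> Ob0 K"
      using A small_C by simp_all
    have dag: "dag2 K A C \<phi> = (G, F, \<lambda>B\<in>Ob A. Dag C (\<gamma> B))"
      by (simp add: \<phi> functor_dagcat_def)
    have T\<phi>: "lwh K A C C T \<phi> = (dagfun_comp A T F, dagfun_comp A T G, \<lambda>B\<in>Ob A. FAr T (\<gamma> B))"
      unfolding \<phi> by (rule lwh_T) simp_all
    have Tdag: "lwh K A C C T (dag2 K A C \<phi>)
        = (dagfun_comp A T G, dagfun_comp A T F, \<lambda>B\<in>Ob A. FAr T (Dag C (\<gamma> B)))"
      unfolding dag by (subst lwh_T) (simp_all add: restrict_eq_iff del: T.FAr_Dag)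
    have "(\<forall>B\<in>Ob A. fem_hom X (\<alpha> B) (\<beta> B) (\<gamma> B)) \<longleftrightarrow>
        (\<forall>B\<in>Ob A. Cmp C (\<beta> B) (FAr T (\<gamma> B)) = Cmp C (\<gamma> B) (\<alpha> B)) \<and>
        (\<forall>B\<in>Ob A. Cmp C (\<alpha> B) (FAr T (Dag C (\<gamma> B))) = Cmp C (Dag C (\<gamma> B)) (\<beta> B))"
      by (auto simp: fem_hom_iff simp del: T.FAr_Dag)
    then show ?thesis
      unfolding in_Hom[THEN dagger_2_category.dfm_square_inclusion_iff[OF dagger_2_category_DagCat ob(1) _ ob(2)]]
      unfolding Tdag unfolding T\<phi> dag unfolding \<phi> F G
      by (simp add: functor_dagcat_def restrict_eq_iff del: T.FAr_Dag)
  qed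
  show ?thesis
    unfolding dfm_transformation_iff dagger_2_category.inclusion_components[OF dagger_2_category_DagCat]
    using cells squares by auto
qed

end

text \<open>Naturality of the tautological family at \<open>enc (a, b, f)\<close> is the first
  homomorphism law of \<open>f\<close>.\<close>

lemma dfm_morphism_counit: "dfm_morphism K (On0 incl E) X (fem_counit enc X)"
proof -
  have "natural_transformation E C (dagfun_comp E T (fem_forget enc X)) (fem_forget enc X) (\<lambda>a\<in>Ob E. a)"
    by (auto simp: natural_transformation_def arrows_def elim!: Ar_FEM_E) (auto simp: fem_hom_iff)
  then show ?thesis
    using fem_forget
    by (simp add: dfm_morphism_inclusion_DagCat_iff[OF small_dagger_category_FEM] fem_counit_def)
qed

abbreviation "und x \<equiv> snd (snd (inv enc x))"

section \<open>Unique factorization through the forgetful functor\<close>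

context
  fixes A :: "('u, 'u) dagcat"
  assumes A: "small_dagger_category small A"
begin

lemmas A_cat [simp] = dagger_category.cat_simps[OF A_dagcat[OF A]]

text \<open>Explicit form of the composite of \<open>fem_counit\<close> with an included functor
  \<open>G\<close>, as shown in \<open>comp1_counit\<close>. The objects of \<open>E\<close> being
  structure maps, the object part of \<open>G\<close> already is the required family.\<close>

definition "post G = (dagfun_comp A (fem_forget enc X) G,
  (dagfun_comp A T (dagfun_comp A (fem_forget enc X) G), dagfun_comp A (fem_forget enc X) G,
   restrict (FOb G) (Ob A)))"

definition "post_arrow = (\<lambda>(G, H, \<beta>).
  (post G, post H,
   (dagfun_comp A (fem_forget enc X) G, dagfun_comp A (fem_forget enc X) H,
    \<lambda>B\<in>Ob A. und (\<beta> B))))"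

text \<open>An arrow of \<open>E\<close> is recovered from its endpoints and its underlying arrow;
  hence \<open>G\<close> is determined by its object part and by its composite with the forgetful
  functor.\<close>

lemma FEM_functor_simps:
  assumes "dagger_functor A E G"
  shows "B \<in> Ob A \<Longrightarrow> fem_algebra X (FOb G B)"
    and "f \<in> Ar A \<Longrightarrow> FAr G f = enc (FOb G (Dom A f), FOb G (Cod A f), und (FAr G f))"
    and "f \<in> Ar A \<Longrightarrow> fem_hom X (FOb G (Dom A f)) (FOb G (Cod A f)) (und (FAr G f))"
proof -
  interpret G: dagger_functor A E G by fact
  show "fem_algebra X (FOb G B)" if "B \<in> Ob A"
    using G.FOb_Ob[OF that] by simp
  show "FAr G f = enc (FOb G (Dom A f), FOb G (Cod A f), und (FAr G f))"
    "fem_hom X (FOb G (Dom A f)) (FOb G (Cod A f)) (und (FAr G f))" if f: "f \<in> Ar A"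
    using G.Dom_FAr[OF f] G.Cod_FAr[OF f] Ar_FEM_E[OF G.FAr_Ar[OF f]]
    by (metis (no_types, lifting) Dom_Cod_Dag_FEM(1,2) inv_enc snd_conv)+
qed

lemma FEM_nat_simps:
  assumes "natural_transformation A E G H \<beta>" "B \<in> Ob A"
  shows "\<beta> B = enc (FOb G B, FOb H B, und (\<beta> B))" "fem_hom X (FOb G B) (FOb H B) (und (\<beta> B))"
proof -
  have "\<beta> B \<in> Ar E" "Dom E (\<beta> B) = FOb G B" "Cod E (\<beta> B) = FOb H B"
    using natural_transformation_cells[OF assms] by simp_all
  then show "\<beta> B = enc (FOb G B, FOb H B, und (\<beta> B))"
    "fem_hom X (FOb G B) (FOb H B) (und (\<beta> B))"
    by (auto elim!: Ar_FEM_E)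
qed

lemma comp1_counit:
  assumes "G \<in> dagger_functors A E"
  shows "comp1 (DFMonad K) (On0 incl A) (On0 incl E) X (fem_counit enc X) (on1 incl A E G) = post G"
proof -
  interpret G: dagger_functor A E G
    using assms by (simp add: dagger_functors_iff)
  interpret U: dagger_functor E C "fem_forget enc X"
    by (rule dagger_functor_fem_forget)
  interpret K: dagger_2_category K
    by (rule dagger_2_category_DagCat)
  have ob: "A \<in> Ob0 K" "E \<in> Ob0 K" "C \<in> Ob0 K"
    using A small_dagger_category_FEM small_C by simp_all
  have fe: "fem_forget enc X \<in> Ob (Hom K E C)" "G \<in> Ob (Hom K A E)"
    using fem_forget assms by (simp_all add: functor_dagcat_def)
  \<comment> \<open>The inclusion equips \<open>G\<close> with an identity 2-cell, so only the
    structure cell of the counit survives in the composite.\<close>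
  have "vert K A C (lwh K A E C (fem_forget enc X) (id2 K A E G)) (rwh K A E C (snd (fem_counit enc X)) G)
      = rwh K A E C (snd (fem_counit enc X)) G"
  proof -
    have "snd (fem_counit enc X) \<in> Ar (Hom K E C)" "Cod (Hom K E C) (snd (fem_counit enc X)) = fem_forget enc X"
      using K.dfm_morphism_cells[OF dfm_morphism_counit] ob
      by (simp_all add: fem_counit_def functor_dagcat_def)
    then show ?thesis
      using ob fe by (simp add: K.horiz_id2 del: DagCat_simps)
  qed
  moreover have "rwh K A E C (snd (fem_counit enc X)) G = snd (post G)"
    using FEM_functor_simps(1)[OF G.dagger_functor_axioms] fem_forget T assms
    by (auto simp: fem_counit_def post_def DagCat_def functor_dagcat_def restrict_eq_iff fem_hom_id G.FAr_Ar
        intro!: dagfun_eqI[where C = A and D = C] dagfun_comp_in_dagger_functors)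
  moreover have "comp1 K A E C (fem_forget enc X) G = fst (post G)"
    by (simp add: post_def DagCat_def)
  ultimately show ?thesis
    by (simp add: DFMonad_def dfm_comp_def fem_counit_def DFMonad_inclusion_def Let_def
        del: DagCat_simps)
qed

text \<open>The identity on the forgetful functor contributes identities of \<open>C\<close>, so
  only the underlying arrows of the components remain.\<close>

lemma lwh_counit:
  assumes "\<phi> \<in> Ar (functor_dagcat A E)"
  shows "lwh (DFMonad K) (On0 incl A) (On0 incl E) X (fem_counit enc X) (on2 incl A E \<phi>) = post_arrow \<phi>"
proof -
  obtain G H \<beta> where \<phi>: "\<phi> = (G, H, \<beta>)" and G: "G \<in> dagger_functors A E"
    and H: "H \<in> dagger_functors A E" and \<beta>: "natural_transformation A E G H \<beta>"
    using assms by (auto simp: functor_dagcat_def)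
  have "horiz K A E C (id2 K E C (fem_forget enc X)) \<phi>
      = (dagfun_comp A (fem_forget enc X) G, dagfun_comp A (fem_forget enc X) H,
         \<lambda>B\<in>Ob A. und (\<beta> B))"
  proof -
    have "Cmp C (Ident C (Cod C (FOb H B))) (FAr (fem_forget enc X) (\<beta> B)) = und (\<beta> B)"
      and "fem_algebra X (FOb H B)" if B: "B \<in> Ob A" for B
    proof -
      have alg: "fem_algebra X (FOb G B)" "fem_algebra X (FOb H B)"
        using G H B by (auto simp: dagger_functors_iff intro: FEM_functor_simps(1))
      then show "fem_algebra X (FOb H B)"
        by simp
      have h: "fem_hom X (FOb G B) (FOb H B) (und (\<beta> B))"
        by (rule FEM_nat_simps(2)[OF \<beta> B])
      then have "FAr (fem_forget enc X) (\<beta> B) = und (\<beta> B)"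
        using FEM_nat_simps(1)[OF \<beta> B] fem_forget_simps(2)[OF alg h] by simp
      then show "Cmp C (Ident C (Cod C (FOb H B))) (FAr (fem_forget enc X) (\<beta> B)) = und (\<beta> B)"
        using h by (simp add: fem_hom_iff)
    qed
    then show ?thesis
      by (simp add: \<phi> DagCat_def functor_dagcat_def restrict_eq_iff)
  qed
  then show ?thesis
    using comp1_counit[OF G] comp1_counit[OF H]
    by (simp add: post_arrow_def \<phi> DFMonad_def DFMonad_hom_def DFMonad_inclusion_def fem_counit_def
        functor_dagcat_def Let_def)
qed

text \<open>Injectivity: the object part of \<open>G\<close> is read off the 2-cell, and the arrow
  part off the underlying functor. Surjectivity: from \<open>F\<close> and \<open>\<alpha>\<close>,
  send \<open>B\<close> to the algebra \<open>\<alpha> B\<close> and \<open>f\<close> to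
  \<open>FAr F f\<close>, tagged with its endpoints.\<close>

lemma bij_betw_post: "bij_betw post (dagger_functors A E) {m. dfm_morphism K (On0 incl A) X m}"
proof (rule bij_betw_imageI)
  show "inj_on post (dagger_functors A E)"
  proof
    fix G H assume G: "G \<in> dagger_functors A E" and H: "H \<in> dagger_functors A E"
      and eq: "post G = post H"
    have fG: "dagger_functor A E G" and fH: "dagger_functor A E H"
      using G H by (simp_all add: dagger_functors_iff)
    have ob: "FOb G B = FOb H B" if "B \<in> Ob A" for B
      using eq that by (simp add: post_def restrict_eq_iff)
    have "und (FAr G f) = und (FAr H f)" if f: "f \<in> Ar A" for f
    proof -
      have "FAr (fem_forget enc X) (FAr G f) = FAr (fem_forget enc X) (FAr H f)"
        using eq f by (metis dagfun_comp_simps(2) fst_conv post_def)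
      then show ?thesis
        using dagger_functor.FAr_Ar[OF fG f] dagger_functor.FAr_Ar[OF fH f]
        by (simp add: fem_forget_def)
    qed
    then show "G = H"
      using ob FEM_functor_simps(2)[OF fG] FEM_functor_simps(2)[OF fH]
      by (intro dagfun_eqI[OF G H]) (simp, metis A_cat(1,2))
  qed
  show "post ` dagger_functors A E = {m. dfm_morphism K (On0 incl A) X m}"
  proof (intro equalityI subsetI)
    fix m assume "m \<in> post ` dagger_functors A E"
    then obtain G where G: "G \<in> dagger_functors A E" and m: "m = post G"
      by blast
    have f: "dagger_functor A E G"
      using G by (simp add: dagger_functors_iff)
    note GG = FEM_functor_simps[OF f]
    let ?F = "dagfun_comp A (fem_forget enc X) G"
    have U: "FAr (fem_forget enc X) (FAr G f) = und (FAr G f)" if "f \<in> Ar A" for f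
      using dagger_functor.FAr_Ar[OF f that] by (simp add: fem_forget_def)
    have "natural_transformation A C (dagfun_comp A T ?F) ?F (restrict (FOb G) (Ob A))"
      using GG by (auto simp: natural_transformation_def arrows_def U fem_hom_iff)
    then show "m \<in> {m. dfm_morphism K (On0 incl A) X m}"
      using GG(1) dagfun_comp_in_dagger_functors[OF fem_forget G]
      by (simp add: m post_def dfm_morphism_inclusion_DagCat_iff[OF A])
  next
    fix m assume "m \<in> {m. dfm_morphism K (On0 incl A) X m}"
    then obtain F \<alpha> where m: "m = (F, (dagfun_comp A T F, F, \<alpha>))" and F: "F \<in> dagger_functors A C"
      and \<alpha>: "natural_transformation A C (dagfun_comp A T F) F \<alpha>"
      and alg [simp]: "\<And>B. B \<in> Ob A \<Longrightarrow> fem_algebra X (\<alpha> B)"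
      by (cases m) (auto simp: dfm_morphism_inclusion_DagCat_iff[OF A])
    interpret F: dagger_functor A C F
      using F by (simp add: dagger_functors_iff)
    note [simp] = F.functor_simps natural_transformation_cells[OF \<alpha>]
    \<comment> \<open>Naturality at \<open>f\<close> gives the first homomorphism law of
      \<open>FAr F f\<close>, naturality at \<open>Dag A f\<close> the second.\<close>
    have hom [simp]: "fem_hom X (\<alpha> (Dom A f)) (\<alpha> (Cod A f)) (FAr F f)" if f: "f \<in> Ar A" for f
      using natural_transformation_natural[OF \<alpha> f refl refl]
        natural_transformation_natural[OF \<alpha> F.C.Dag_Ar[OF f] refl refl] f
      by (simp add: fem_hom_iff)
    define G where "G = \<lparr>FOb = restrict \<alpha> (Ob A),
      FAr = (\<lambda>f\<in>Ar A. enc (\<alpha> (Dom A f), \<alpha> (Cod A f), FAr F f))\<rparr>"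
    have "dagger_functor A E G"
    proof (intro dagger_functor.intro dagger_functor_axioms.intro F.C.dagger_category_axioms
        dagger_category_FEM)
      show "FAr G (Cmp A g f) = Cmp E (FAr G g) (FAr G f)"
        if "f \<in> arrows A B B'" "g \<in> arrows A B' B''" for f g B B' B''
        using that hom[of f] hom[of g] by (auto simp: G_def arrows_def)
    qed (auto simp: G_def arrows_def)
    then have G: "G \<in> dagger_functors A E"
      by (simp add: dagger_functors_iff) (simp add: G_def)
    have UG: "dagfun_comp A (fem_forget enc X) G = F"
      by (rule dagfun_eqI[OF dagfun_comp_in_dagger_functors[OF fem_forget G] F])
        (auto simp: G_def)
    have "restrict (FOb G) (Ob A) = \<alpha>"
      using natural_transformation_extensional[OF \<alpha>] by (simp add: G_def extensional_restrict)
    then have "m = post G"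
      by (simp add: post_def m UG)
    then show "m \<in> post ` dagger_functors A E"
      using G by blast
  qed
qed

text \<open>The endpoints are handled by \<open>bij_betw_post\<close>. Components in
  \<open>E\<close> and in \<open>C\<close> differ only by tags that the endpoints determine, and
  naturality in \<open>E\<close> amounts to naturality of the underlying arrows.\<close>

lemma bij_betw_post_arrow:
  "bij_betw post_arrow (Ar (functor_dagcat A E)) (Ar (DFMonad_hom K (On0 incl A) X))"
proof (rule bij_betw_imageI)
  show "inj_on post_arrow (Ar (functor_dagcat A E))"
  proof
    fix \<phi> \<psi> assume \<phi>: "\<phi> \<in> Ar (functor_dagcat A E)" and \<psi>: "\<psi> \<in> Ar (functor_dagcat A E)"
      and eq: "post_arrow \<phi> = post_arrow \<psi>"
    obtain G H \<beta> where G: "\<phi> = (G, H, \<beta>)" "G \<in> dagger_functors A E" "H \<in> dagger_functors A E"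
      and \<beta>: "natural_transformation A E G H \<beta>"
      using \<phi> by (auto simp: functor_dagcat_def)
    obtain G' H' \<gamma> where G': "\<psi> = (G', H', \<gamma>)" "G' \<in> dagger_functors A E" "H' \<in> dagger_functors A E"
      and \<gamma>: "natural_transformation A E G' H' \<gamma>"
      using \<psi> by (auto simp: functor_dagcat_def)
    have "post G = post G'" "post H = post H'" and und: "\<And>B. B \<in> Ob A \<Longrightarrow> und (\<beta> B) = und (\<gamma> B)"
      using eq by (auto simp: post_arrow_def G G' restrict_eq_iff)
    then have [simp]: "G' = G" "H' = H"
      using bij_betw_post G G' by (auto simp: bij_betw_def inj_on_def)
    have "\<beta> = \<gamma>"
    proof (rule extensionalityI)
      show "\<beta> \<in> extensional (Ob A)" "\<gamma> \<in> extensional (Ob A)"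
        using \<beta> \<gamma> natural_transformation_extensional by blast+
      show "\<beta> B = \<gamma> B" if "B \<in> Ob A" for B
        using FEM_nat_simps(1)[OF \<beta> that] FEM_nat_simps(1)[OF \<gamma> that] und[OF that] by simp
    qed
    then show "\<phi> = \<psi>"
      by (simp add: G G')
  qed
  have post_dfm: "dfm_morphism K (On0 incl A) X (post G)" if "G \<in> dagger_functors A E" for G
    using bij_betw_post that by (auto simp: bij_betw_def)
  have transf: "dfm_transformation K (On0 incl A) X (post G) (post H) \<phi> \<longleftrightarrow>
      (\<exists>\<gamma>. \<phi> = (fst (post G), fst (post H), \<gamma>) \<and>
        natural_transformation A C (fst (post G)) (fst (post H)) \<gamma> \<and>
        (\<forall>B\<in>Ob A. fem_hom X (FOb G B) (FOb H B) (\<gamma> B)))"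
    if "G \<in> dagger_functors A E" "H \<in> dagger_functors A E" for G H \<phi>
    using dfm_transformation_inclusion_DagCat_iff[OF A post_dfm[OF that(1), unfolded post_def]
        post_dfm[OF that(2), unfolded post_def]]
    by (simp add: post_def)
  show "post_arrow ` Ar (functor_dagcat A E) = Ar (DFMonad_hom K (On0 incl A) X)"
  proof (intro equalityI subsetI)
    fix t assume "t \<in> post_arrow ` Ar (functor_dagcat A E)"
    then obtain G H \<beta> where G: "G \<in> dagger_functors A E" "H \<in> dagger_functors A E"
      and \<beta>: "natural_transformation A E G H \<beta>" and t: "t = post_arrow (G, H, \<beta>)"
      by (auto simp: functor_dagcat_def)
    have f: "dagger_functor A E G" "dagger_functor A E H"
      using G by (simp_all add: dagger_functors_iff)
    have U: "FAr (fem_forget enc X) (FAr G' f) = und (FAr G' f)"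
      if "f \<in> Ar A" "dagger_functor A E G'" for f G'
      using dagger_functor.FAr_Ar[OF that(2,1)] by (simp add: fem_forget_def)
    note GG = FEM_functor_simps[OF f(1)] and HH = FEM_functor_simps[OF f(2)]
    have "Cmp C (und (\<beta> (Cod A f))) (und (FAr G f)) = Cmp C (und (FAr H f)) (und (\<beta> (Dom A f)))"
      if f: "f \<in> Ar A" for f
    proof -
      have AA: "Dom A f \<in> Ob A" "Cod A f \<in> Ob A"
        using f by simp_all
      have "Cmp E (\<beta> (Cod A f)) (FAr G f) = Cmp E (FAr H f) (\<beta> (Dom A f))"
        by (rule natural_transformation_natural[OF \<beta> f refl refl])
      then show ?thesis
        using GG(1)[OF AA(1)] GG(1)[OF AA(2)] HH(1)[OF AA(1)] HH(1)[OF AA(2)] GG(3)[OF f] HH(3)[OF f]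
          FEM_nat_simps(2)[OF \<beta> AA(1)] FEM_nat_simps(2)[OF \<beta> AA(2)]
        \<comment> \<open>The equations are applied singly because each right side contains its left
          side under \<open>und\<close>. Once all four arrows are in coded form, composition can be
          evaluated and injectivity of \<open>enc\<close> compares the underlying arrows.\<close>
        by (subst (asm) FEM_nat_simps(1)[OF \<beta> AA(2)], subst (asm) FEM_nat_simps(1)[OF \<beta> AA(1)],
            subst (asm) GG(2)[OF f], subst (asm) HH(2)[OF f]) simp
    qed
    then have "natural_transformation A C (fst (post G)) (fst (post H)) (\<lambda>B\<in>Ob A. und (\<beta> B))"
      using GG(1) HH(1) FEM_nat_simps(2)[OF \<beta>] f
      by (auto simp: natural_transformation_def arrows_def post_def U fem_hom_iff)
    then show "t \<in> Ar (DFMonad_hom K (On0 incl A) X)"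
      using FEM_nat_simps(2)[OF \<beta>] post_dfm G
      by (auto simp: t DFMonad_hom_def post_arrow_def transf) (auto simp: post_def)
  next
    fix t assume t: "t \<in> Ar (DFMonad_hom K (On0 incl A) X)"
    then obtain m n \<phi> where mn: "t = (m, n, \<phi>)" "dfm_morphism K (On0 incl A) X m"
      "dfm_morphism K (On0 incl A) X n" and tr: "dfm_transformation K (On0 incl A) X m n \<phi>"
      by (auto simp: DFMonad_hom_def)
    obtain G H where G: "G \<in> dagger_functors A E" "m = post G" "H \<in> dagger_functors A E" "n = post H"
      using mn(2,3) bij_betw_post unfolding bij_betw_def by blast
    obtain \<gamma> where \<phi>: "\<phi> = (fst (post G), fst (post H), \<gamma>)"
      and \<gamma>: "natural_transformation A C (fst (post G)) (fst (post H)) \<gamma>"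
      and hom: "\<And>B. B \<in> Ob A \<Longrightarrow> fem_hom X (FOb G B) (FOb H B) (\<gamma> B)"
      using tr transf[OF G(1,3)] G by auto
    have f: "dagger_functor A E G" "dagger_functor A E H"
      using G by (simp_all add: dagger_functors_iff)
    have U: "FAr (fem_forget enc X) (FAr G' f) = und (FAr G' f)"
      if "f \<in> Ar A" "dagger_functor A E G'" for f G'
      using dagger_functor.FAr_Ar[OF that(2,1)] by (simp add: fem_forget_def)
    note GG = FEM_functor_simps[OF f(1)] and HH = FEM_functor_simps[OF f(2)]
    \<comment> \<open>The given components are tagged with the algebras that \<open>G\<close> and
      \<open>H\<close> assign; these agree with the structure maps of \<open>m\<close> and
      \<open>n\<close>.\<close>
    define \<beta> where "\<beta> = (\<lambda>B\<in>Ob A. enc (FOb G B, FOb H B, \<gamma> B))"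
    have "Cmp E (\<beta> (Cod A f)) (FAr G f) = Cmp E (FAr H f) (\<beta> (Dom A f))" if f': "f \<in> Ar A" for f
    proof -
      have AA: "Dom A f \<in> Ob A" "Cod A f \<in> Ob A"
        using f' by simp_all
      have "Cmp C (\<gamma> (Cod A f)) (und (FAr G f)) = Cmp C (und (FAr H f)) (\<gamma> (Dom A f))"
        using natural_transformation_natural[OF \<gamma> f' refl refl] f' f by (simp add: post_def U)
      then show ?thesis
        using AA GG(1)[OF AA(1)] GG(1)[OF AA(2)] HH(1)[OF AA(1)] HH(1)[OF AA(2)] GG(3)[OF f'] HH(3)[OF f']
          hom[OF AA(1)] hom[OF AA(2)]
        by (subst GG(2)[OF f'], subst HH(2)[OF f']) (simp add: \<beta>_def)
    qed
    then have "natural_transformation A E G H \<beta>"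
      using GG(1) HH(1) hom by (auto simp: natural_transformation_def arrows_def \<beta>_def)
    moreover have "t = post_arrow (G, H, \<beta>)"
      using natural_transformation_extensional[OF \<gamma>]
      by (auto simp: mn G \<phi> post_arrow_def \<beta>_def post_def extensional_restrict intro!: extensionalityI)
    ultimately show "t \<in> post_arrow ` Ar (functor_dagcat A E)"
      using G by (auto simp: functor_dagcat_def)
  qed
qed

end

end

theorem theorem7p6:
  fixes small :: "'u set \<Rightarrow> bool"
  assumes "smallness small"
  shows "admits_FEM_algebras (DagCat small)"
proof -
  let ?K = "DagCat small"
  interpret K: dagger_2_category ?K
    by (rule dagger_2_category_DagCat)
  have "infinite (UNIV :: 'u set)"
    using assms by (simp add: smallness_def)
  \<comment> \<open>An infinite type is equipotent to its square; the resulting pairing, nested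
    once, codes the tagged homomorphisms.\<close>
  then have "(UNIV :: 'u set) \<times> (UNIV :: 'u set) \<approx> (UNIV :: 'u set)"
    unfolding eqpoll_iff_card_of_ordIso by (rule card_of_Times_same_infinite)
  then obtain pair :: "'u \<times> 'u \<Rightarrow> 'u" where pair: "inj pair"
    by (auto simp: eqpoll_def bij_betw_def)
  define enc where "enc = (\<lambda>(a, b, f). pair (a, pair (b, f)))"
  have enc: "inj enc"
    by (rule injI) (auto simp: enc_def inj_eq[OF pair])
  have fem: "fem small enc X" if "X \<in> Ob0 (DFMonad ?K)" for X
    using assms enc that by unfold_locales (simp_all add: DFMonad_def)
  have "universal_arrows ?K (DFMonad ?K) (DFMonad_inclusion ?K) (FEM enc) (fem_counit enc)"
  proof (intro universal_arrows.intro universal_arrows_axioms.intro K.dagger_2_functor_inclusion)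
    fix X assume X: "X \<in> Ob0 (DFMonad ?K)"
    interpret fem small enc X by (rule fem[OF X])
    show "FEM enc X \<in> Ob0 ?K"
      using small_dagger_category_FEM by simp
    show "fem_counit enc X \<in> Ob (Hom (DFMonad ?K) (On0 (DFMonad_inclusion ?K) (FEM enc X)) X)"
      using dfm_morphism_counit by (simp add: DFMonad_def DFMonad_hom_def)
    fix A assume "A \<in> Ob0 ?K"
    then have A: "small_dagger_category small A"
      by simp
    \<comment> \<open>On the hom-category in question, composition with the counit agrees with the
      explicit map \<open>post A\<close>, so its bijectivity carries over.\<close>
    show "bij_betw (\<lambda>F. comp1 (DFMonad ?K) (On0 (DFMonad_inclusion ?K) A)
          (On0 (DFMonad_inclusion ?K) (FEM enc X)) X (fem_counit enc X)
          (on1 (DFMonad_inclusion ?K) A (FEM enc X) F))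
        (Ob (Hom ?K A (FEM enc X))) (Ob (Hom (DFMonad ?K) (On0 (DFMonad_inclusion ?K) A) X))"
      using bij_betw_post[OF A] comp1_counit[OF A]
      by (subst bij_betw_cong[where g = "post A"])
        (simp_all add: DFMonad_def[of ?K] DFMonad_hom_def functor_dagcat_def)
    show "bij_betw (\<lambda>\<phi>. lwh (DFMonad ?K) (On0 (DFMonad_inclusion ?K) A)
          (On0 (DFMonad_inclusion ?K) (FEM enc X)) X (fem_counit enc X)
          (on2 (DFMonad_inclusion ?K) A (FEM enc X) \<phi>))
        (Ar (Hom ?K A (FEM enc X))) (Ar (Hom (DFMonad ?K) (On0 (DFMonad_inclusion ?K) A) X))"
      using bij_betw_post_arrow[OF A] lwh_counit[OF A]
      by (subst bij_betw_cong[where g = "post_arrow A"])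
        (simp_all add: DFMonad_def[of ?K])
  qed
  then show ?thesis
    using universal_arrows.has_right_adjoint K.dagger_2_category_axioms
    by (auto simp: admits_FEM_algebras_def)
qed

end
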